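(* Consider the homogeneous post-local algorithm (see context) with deterministic schedules $(\vartheta_t)$, $(\Lambda_t)$ satisfying $L<\Lambda_t\le2L$ and $\Lambda_t\vartheta_t\le L/2$ for every $t\ge0$. Then, for every $t\ge0$, $$g_{t+1}\le g_t-\underline A_t^{\mathrm{hom}}g_t^2+\beta_t^{\mathrm{hom}}g_t+\delta_t^{\mathrm{hom}}.$$ If, in addition, $\vartheta_t\equiv\vartheta$ and $\Lambda_t\equiv\Lambda$, define $$\underline A^{\mathrm{hom}}:=\frac{\vartheta}{4LR^2(1+\vartheta/8)},\qquad \beta^{\mathrm{hom}}:=16\vartheta^3+16\frac{L\vartheta^2}{\Lambda-L},$$ $$\delta^{\mathrm{hom}}:=\Bigl(4\frac{\vartheta^3}L+4\frac{\vartheta^2}{\Lambda-L}\Bigr)\bar V_1+\Bigl(\frac\vartheta L+\frac1{\Lambda-L}\Bigr)V_u.$$ If $m^{\mathrm{hom}}\ge0$ satisfies $\underline A^{\mathrm{hom}}(m^{\mathrm{hom}})^2-\beta^{\mathrm{hom}}m^{\mathrm{hom}}-\delta^{\mathrm{hom}}\ge0$ and $2\underline A^{\mathrm{hom}}m^{\mathrm{hom}}\le1+\beta^{\mathrm{hom}}$, then for every $T\ge0$, $$g_T\le m^{\mathrm{hom}}+\frac1{((g_0-m^{\mathrm{hom}})_+)^{-1}+\underline A^{\mathrm{hom}}T}.$$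
   Context: Problem: $F(x)=\frac1n\sum_{i=1}^nF_i(x)$, $F_i(x)=\frac1{m_i}\sum_{j=1}^{m_i}\phi_{ij}(x)$, each $\phi_{ij}:\mathbb R^d\to\mathbb R$ convex and $L$-smooth ($L$-Lipschitz gradient). There are $x_\star\in\arg\min F$ and $R>0$; $B(x_\star,R)=\{x:\|x-x_\star\|\le R\}$, $F_\star:=F(x_\star)$. Node $i$ has horizon $H_i\ge1$, minibatch size $b_i$, and $v_i^2:=\sup_{x\in B(x_\star,R)}\frac1{m_i}\sum_j\|\nabla\phi_{ij}(x)-\nabla F_i(x)\|^2$. Homogeneous post-local algorithm (all nodes active). In round $t$, with amplitude $\vartheta_t\in[\underline\theta,\bar\theta]$ ($0<\underline\theta\le\bar\theta$) and curvature $\Lambda_t>L$, each $i\in[n]$ sets $\eta_{i,t}=\vartheta_t/(LH_i)$, $y_{i,t}^{(0)}=x_t$ and, for $\ell=0,\dots,H_i-1$, draws a minibatch $\mathcal B_{i,t,\ell}$, computes a stochastic gradient $g_{i,t,\ell}$ and sets $y_{i,t}^{(\ell+1)}=y_{i,t}^{(\ell)}-\eta_{i,t}g_{i,t,\ell}$. Put $\Delta_{i,t}=y_{i,t}^{(H_i)}-x_t$, $g_{i,t}^{\mathrm{loc}}=-(\eta_{i,t}H_i)^{-1}\Delta_{i,t}$, $\bar g_t=\frac1n\sum_ig_{i,t}^{\mathrm{loc}}$, $$\Psi_t^{\mathrm{hom}}(w)=\Bigl\langle\bar g_t,\sum_iw_i\Delta_{i,t}\Bigr\rangle+\frac{\Lambda_t}2\Bigl\|\sum_iw_i\Delta_{i,t}\Bigr\|^2.$$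 The server picks $w_t^{\mathrm{hom}}\in\arg\min_{w\in\Delta_n}\Psi_t^{\mathrm{hom}}(w)$, $\Delta_n=\{w\in\mathbb R_+^n:\sum_iw_i=1\}$ (measurably), and sets $x_{t+1}=x_t+\sum_iw_{i,t}^{\mathrm{hom}}\Delta_{i,t}$. Standing assumptions: almost surely $x_t,y_{i,t}^{(\ell)}\in B(x_\star,R)$ for all $t,i,\ell$. $\mathcal F_t$ is generated by the initial state and all minibatches drawn strictly before round $t$; $\mathcal G_{i,t,\ell}$ by $\mathcal F_t$ and all minibatches of node $i$ drawn strictly before local step $\ell$ of round $t$. Conditionally on $\mathcal G_{i,t,\ell}$ the minibatches are independent across nodes and local steps. Homogeneous oracle condition: $\mathbb E[g_{i,t,\ell}\mid\mathcal G_{i,t,\ell}]=\nabla F(y_{i,t}^{(\ell)})$ and $\mathbb E[\|g_{i,t,\ell}-\nabla F(y_{i,t}^{(\ell)})\|^2\mid\mathcal G_{i,t,\ell}]\le v_i^2/b_i$ for every node $i$ and local step $\ell$. Notation: $g_t:=\mathbb E[F(x_t)-F_\star]$; $\bar V_1:=\frac1n\sum_i\frac{v_i^2}{H_ib_i}$; $V_u:=\frac1{n^2}\sum_i\frac{v_i^2}{H_ib_i}$; $\underline A_t^{\mathrm{hom}}:=\frac{\vartheta_t}{4LR^2(1+\vartheta_t/8)}$; $\beta_t^{\mathrm{hom}}:=16\vartheta_t^3+16\frac{L\vartheta_t^2}{\Lambda_t-L}$; $\delta_t^{\mathrm{hom}}:=\bigl(4\frac{\vartheta_t^3}L+4\frac{\vartheta_t^2}{\Lambda_t-L}\bigr)\bar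 V_1+\bigl(\frac{\vartheta_t}L+\frac1{\Lambda_t-L}\bigr)V_u$. Conventions: $(x)_+=\max\{x,0\}$, $0^{-1}=\infty$, $1/\infty=0$. *)

theory Defs
  imports "HOL-Probability.Probability"
begin

section \<open>Analysis and probability notions\<close>

definition gradient :: "('a::euclidean_space \<Rightarrow> real) \<Rightarrow> 'a \<Rightarrow> 'a" where
  "gradient f x = (THE D. GDERIV f x :> D)"

definition L_smooth :: "real \<Rightarrow> ('a::euclidean_space \<Rightarrow> real) \<Rightarrow> bool" where
  "L_smooth L f \<longleftrightarrow> (\<forall>x. f differentiable (at x)) \<and> L-lipschitz_on UNIV (gradient f)"

definition weight_simplex :: "(real ^ 'n::finite) set" where
  "weight_simplex = {w. (\<forall>i. 0 \<le> w $ i) \<and> (\<Sum>i\<in>UNIV. w $ i) = 1}"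

text \<open>The library only has conditional expectations of real functions; a Euclidean-valued
  function is conditioned coordinatewise.\<close>

definition vec_cond_exp :: "'w measure \<Rightarrow> 'w measure \<Rightarrow> ('w \<Rightarrow> 'a::euclidean_space) \<Rightarrow> 'w \<Rightarrow> 'a" where
  "vec_cond_exp M G X \<omega> = (\<Sum>e\<in>Basis. real_cond_exp M G (\<lambda>\<omega>'. X \<omega>' \<bullet> e) \<omega> *\<^sub>R e)"

text \<open>Conditional counterpart of \<^const>\<open>prob_space.indep_vars\<close>: the conditional probabilities
  given \<open>G\<close> of finitely many events, one for each variable, factorise almost surely.\<close>

definition cond_indep_vars ::
  "'w measure \<Rightarrow> 'w measure \<Rightarrow> ('i \<Rightarrow> 'b measure) \<Rightarrow> ('i \<Rightarrow> 'w \<Rightarrow> 'b) \<Rightarrow> 'i set \<Rightarrow> bool" where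
  "cond_indep_vars M G N X I \<longleftrightarrow>
     (\<forall>i\<in>I. X i \<in> measurable M (N i)) \<and>
     (\<forall>J\<subseteq>I. J \<noteq> {} \<longrightarrow> finite J \<longrightarrow> (\<forall>A\<in>(\<Pi> j\<in>J. sets (N j)).
        AE \<omega> in M. real_cond_exp M G (indicator (\<Inter>j\<in>J. X j -` A j \<inter> space M)) \<omega> =
          (\<Prod>j\<in>J. real_cond_exp M G (indicator (X j -` A j \<inter> space M)) \<omega>)))"


section \<open>The finite-sum problem\<close>

definition node_obj :: "('n::finite \<Rightarrow> nat) \<Rightarrow> ('n \<Rightarrow> nat \<Rightarrow> 'a::euclidean_space \<Rightarrow> real) \<Rightarrow> 'n \<Rightarrow> 'a \<Rightarrow> real" where
  "node_obj m \<phi> i x = 1 / real (m i) * (\<Sum>j\<in>{1..m i}. \<phi> i j x)"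

definition global_obj :: "('n::finite \<Rightarrow> nat) \<Rightarrow> ('n \<Rightarrow> nat \<Rightarrow> 'a::euclidean_space \<Rightarrow> real) \<Rightarrow> 'a \<Rightarrow> real" where
  "global_obj m \<phi> x = 1 / real CARD('n) * (\<Sum>i\<in>UNIV. node_obj m \<phi> i x)"

text \<open>This is \<open>v\<^sub>i\<^sup>2\<close>.\<close>

definition node_var ::
  "('n::finite \<Rightarrow> nat) \<Rightarrow> ('n \<Rightarrow> nat \<Rightarrow> 'a::euclidean_space \<Rightarrow> real) \<Rightarrow> 'a \<Rightarrow> real \<Rightarrow> 'n \<Rightarrow> real" where
  "node_var m \<phi> xstar R i = (SUP x\<in>cball xstar R.
     1 / real (m i) * (\<Sum>j\<in>{1..m i}. (norm (gradient (\<phi> i j) x - gradient (node_obj m \<phi> i) x))\<^sup>2))"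


section \<open>The homogeneous post-local algorithm\<close>

text \<open>Nodes are the elements of \<open>'n\<close>.  For node \<open>i\<close>, round \<open>t\<close> and local step \<open>l\<close>,
  \<open>B i t l\<close> is the minibatch, \<open>g i t l\<close> the stochastic gradient and \<open>y i t l\<close> the local iterate;
  \<open>x t\<close> is the server iterate and \<open>w t\<close> the weight vector.  A minibatch is a multiset of component
  indices, which allows sampling with or without replacement.\<close>

locale post_local_setup =
  fixes M :: "'w measure"
    and m :: "'n::finite \<Rightarrow> nat"
    and \<phi> :: "'n \<Rightarrow> nat \<Rightarrow> 'a::euclidean_space \<Rightarrow> real"
    and L :: real and xstar :: 'a and R :: real
    and H :: "'n \<Rightarrow> nat" and b :: "'n \<Rightarrow> nat"
    and \<theta>lo \<theta>hi :: real and \<theta> \<Lambda> :: "nat \<Rightarrow> real"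
    and B :: "'n \<Rightarrow> nat \<Rightarrow> nat \<Rightarrow> 'w \<Rightarrow> nat multiset"
    and g :: "'n \<Rightarrow> nat \<Rightarrow> nat \<Rightarrow> 'w \<Rightarrow> 'a"
    and y :: "'n \<Rightarrow> nat \<Rightarrow> nat \<Rightarrow> 'w \<Rightarrow> 'a"
    and x :: "nat \<Rightarrow> 'w \<Rightarrow> 'a"
    and w :: "nat \<Rightarrow> 'w \<Rightarrow> real ^ 'n"
begin

definition minibatch_space :: "'n \<Rightarrow> nat multiset measure" where
  "minibatch_space i = count_space {S. size S = b i \<and> set_mset S \<subseteq> {1..m i}}"

definition stepsize :: "'n \<Rightarrow> nat \<Rightarrow> real" where
  "stepsize i t = \<theta> t / (L * real (H i))"

definition displacement :: "'n \<Rightarrow> nat \<Rightarrow> 'w \<Rightarrow> 'a" where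
  "displacement i t \<omega> = y i t (H i) \<omega> - x t \<omega>"

definition local_grad :: "'n \<Rightarrow> nat \<Rightarrow> 'w \<Rightarrow> 'a" where
  "local_grad i t \<omega> = - (inverse (stepsize i t * real (H i)) *\<^sub>R displacement i t \<omega>)"

definition mean_grad :: "nat \<Rightarrow> 'w \<Rightarrow> 'a" where
  "mean_grad t \<omega> = (1 / real CARD('n)) *\<^sub>R (\<Sum>i\<in>UNIV. local_grad i t \<omega>)"

definition step :: "nat \<Rightarrow> 'w \<Rightarrow> real ^ 'n \<Rightarrow> 'a" where
  "step t \<omega> u = (\<Sum>i\<in>UNIV. (u $ i) *\<^sub>R displacement i t \<omega>)"

definition Psi_hom :: "nat \<Rightarrow> 'w \<Rightarrow> real ^ 'n \<Rightarrow> real" where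
  "Psi_hom t \<omega> u = mean_grad t \<omega> \<bullet> step t \<omega> u + \<Lambda> t / 2 * (norm (step t \<omega> u))\<^sup>2"

definition round_events :: "nat \<Rightarrow> 'w set set" where
  "round_events t =
     {x 0 -` A \<inter> space M | A. A \<in> sets borel} \<union>
     {B i s l -` A \<inter> space M | i s l A. s < t \<and> l < H i}"

text \<open>The sigma-algebras \<open>\<F>\<^sub>t\<close> and \<open>\<G>\<^sub>i\<^sub>,\<^sub>t\<^sub>,\<^sub>l\<close>.\<close>

definition round_alg :: "nat \<Rightarrow> 'w measure" where
  "round_alg t = sigma (space M) (round_events t)"

definition local_alg :: "'n \<Rightarrow> nat \<Rightarrow> nat \<Rightarrow> 'w measure" where
  "local_alg i t l = sigma (space M) (round_events t \<union> {B i t k -` A \<inter> space M | k A. k < l})"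

end

text \<open>Two measurability conventions.  The stochastic gradient \<open>g i t l\<close> is any vector computable
  from the information of node \<open>i\<close> once \<open>B i t l\<close> is drawn.  The weights \<open>w t\<close> are selected
  measurably from the information available at the end of round \<open>t\<close>, so that \<open>x t\<close> is
  measurable with respect to \<open>round_alg t\<close>.

  No integrability has to be required in the oracle conditions: consecutive local iterates lie in
  \<open>cball xstar R\<close> almost surely, hence every \<open>g i t l\<close> is almost surely bounded.\<close>

locale hom_post_local = post_local_setup + prob_space M +
  assumes components: "\<And>i. 1 \<le> m i"
    and convex: "\<And>i j. j \<in> {1..m i} \<Longrightarrow> convex_on UNIV (\<phi> i j)"
    and smooth: "\<And>i j. j \<in> {1..m i} \<Longrightarrow> L_smooth L (\<phi> i j)"
    and minimizer: "is_arg_min (global_obj m \<phi>) (\<lambda>_. True) xstar"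
    and radius: "0 < R"
    and horizon: "\<And>i. 1 \<le> H i"
    and batch_size: "\<And>i. 1 \<le> b i"
    and amplitude_bounds: "0 < \<theta>lo" "\<theta>lo \<le> \<theta>hi"
    and amplitude: "\<And>t. \<theta> t \<in> {\<theta>lo..\<theta>hi}"
    and curvature: "\<And>t. L < \<Lambda> t"
    and init_meas: "x 0 \<in> borel_measurable M"
    and batch_meas: "\<And>i t l. l < H i \<Longrightarrow> B i t l \<in> measurable M (minibatch_space i)"
    and grad_meas: "\<And>i t l. l < H i \<Longrightarrow> g i t l \<in> borel_measurable (local_alg i t (Suc l))"
    and local_init: "\<And>i t \<omega>. \<omega> \<in> space M \<Longrightarrow> y i t 0 \<omega> = x t \<omega>"
    and local_step: "\<And>i t l \<omega>. l < H i \<Longrightarrow> \<omega> \<in> space M \<Longrightarrow>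
          y i t (Suc l) \<omega> = y i t l \<omega> - stepsize i t *\<^sub>R g i t l \<omega>"
    and weight_meas: "\<And>t. w t \<in> borel_measurable (round_alg (Suc t))"
    and weight_opt: "\<And>t \<omega>. \<omega> \<in> space M \<Longrightarrow>
          is_arg_min (Psi_hom t \<omega>) (\<lambda>u. u \<in> weight_simplex) (w t \<omega>)"
    and server_step: "\<And>t \<omega>. \<omega> \<in> space M \<Longrightarrow> x (Suc t) \<omega> = x t \<omega> + step t \<omega> (w t \<omega>)"
    and iterates_in_ball: "AE \<omega> in M. \<forall>t. x t \<omega> \<in> cball xstar R \<and>
          (\<forall>i. \<forall>l\<le>H i. y i t l \<omega> \<in> cball xstar R)"
    and batches_indep: "\<And>i t l. l < H i \<Longrightarrow>
          cond_indep_vars M (local_alg i t l) (\<lambda>(j, k). minibatch_space j)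
            (\<lambda>(j, k). B j t k) {(j, k). k < H j}"
    and oracle_mean: "\<And>i t l. l < H i \<Longrightarrow>
          AE \<omega> in M. vec_cond_exp M (local_alg i t l) (g i t l) \<omega> =
            gradient (global_obj m \<phi>) (y i t l \<omega>)"
    and oracle_var: "\<And>i t l. l < H i \<Longrightarrow>
          AE \<omega> in M. real_cond_exp M (local_alg i t l)
              (\<lambda>\<omega>'. (norm (g i t l \<omega>' - gradient (global_obj m \<phi>) (y i t l \<omega>')))\<^sup>2) \<omega>
            \<le> node_var m \<phi> xstar R i / real (b i)"


section \<open>The constants of the rate\<close>

definition opt_gap ::
  "'w measure \<Rightarrow> ('n::finite \<Rightarrow> nat) \<Rightarrow> ('n \<Rightarrow> nat \<Rightarrow> 'a::euclidean_space \<Rightarrow> real) \<Rightarrow> 'a \<Rightarrow>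
   (nat \<Rightarrow> 'w \<Rightarrow> 'a) \<Rightarrow> nat \<Rightarrow> real" where
  "opt_gap M m \<phi> xstar x t = (LINT \<omega>|M. global_obj m \<phi> (x t \<omega>) - global_obj m \<phi> xstar)"

definition V1_bar :: "('n::finite \<Rightarrow> real) \<Rightarrow> ('n \<Rightarrow> nat) \<Rightarrow> ('n \<Rightarrow> nat) \<Rightarrow> real" where
  "V1_bar vsq H b = 1 / real CARD('n) * (\<Sum>i\<in>UNIV. vsq i / (real (H i) * real (b i)))"

definition V_u :: "('n::finite \<Rightarrow> real) \<Rightarrow> ('n \<Rightarrow> nat) \<Rightarrow> ('n \<Rightarrow> nat) \<Rightarrow> real" where
  "V_u vsq H b = 1 / (real CARD('n))\<^sup>2 * (\<Sum>i\<in>UNIV. vsq i / (real (H i) * real (b i)))"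

definition A_hom :: "real \<Rightarrow> real \<Rightarrow> real \<Rightarrow> real" where
  "A_hom L R \<theta> = \<theta> / (4 * L * R\<^sup>2 * (1 + \<theta> / 8))"

definition beta_hom :: "real \<Rightarrow> real \<Rightarrow> real \<Rightarrow> real" where
  "beta_hom L \<theta> \<Lambda> = 16 * \<theta> ^ 3 + 16 * (L * \<theta>\<^sup>2 / (\<Lambda> - L))"

definition delta_hom :: "real \<Rightarrow> real \<Rightarrow> real \<Rightarrow> real \<Rightarrow> real \<Rightarrow> real" where
  "delta_hom L V1 Vu \<theta> \<Lambda> =
     (4 * (\<theta> ^ 3 / L) + 4 * (\<theta>\<^sup>2 / (\<Lambda> - L))) * V1 + (\<theta> / L + 1 / (\<Lambda> - L)) * Vu"

end

theory Submission
  imports Defs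
begin

text \<open>
  Write \<open>F\<close> for the objective, \<open>s\<close> for the server step and \<open>q\<close> for the averaged local gradient of a
  round.  The weights minimise a quadratic model with gradient \<open>q\<close> and curvature \<open>\<Lambda> > L\<close>, so they do at
  least as well as uniform weights, for which \<open>s = - (\<theta> / L) q\<close>.  Together with the descent inequality
  of the \<open>L\<close>-smooth function \<open>F\<close> this yields (\<open>model_step_descent\<close>)
  \<open>F (x + s) \<le> F x - \<theta> / (4 L) |\<nabla>F x|\<^sup>2 + (\<theta> / (2 L) + 1 / (2 (\<Lambda> - L))) |\<nabla>F x - q|\<^sup>2\<close>;
  the margin \<open>\<Lambda> - L\<close> pays for the inexact gradient.

  The error \<open>\<nabla>F x - q\<close> is a bias plus an average of noise terms.  The bias is controlled by the drift of
  the local iterates (\<open>local_drift\<close>), which is of order \<open>\<theta>\<close> because the local steps of a node have total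
  length \<open>\<theta> / L\<close>.  The noise terms of a round are pairwise uncorrelated (\<open>noise_orthogonal\<close>): within a
  node because they are martingale differences, across nodes because the minibatches are independent
  conditionally on the past (\<open>cond_indep_integral_mult_zero\<close>).  So their second moments add, which
  produces the two variance constants.  Finally \<open>|\<nabla>F x|\<^sup>2 \<le> 2 L (F x - F\<^sub>\<star>)\<close> by smoothness, and
  \<open>F x - F\<^sub>\<star> \<le> R |\<nabla>F x|\<close> by convexity inside the ball; taking expectations, with Jensen's inequality
  for the square, gives the one-round recursion (\<open>expected_descent\<close>).

  For constant schedules and a level \<open>\<mu> > 0\<close>, the conditions on \<open>\<mu>\<close> make the excess \<open>e = g - \<mu>\<close> satisfy
  \<open>e\<^sub>t\<^sub>+\<^sub>1 \<le> e\<^sub>t - A e\<^sub>t\<^sup>2\<close> while it is positive and stay nonpositive afterwards, whence the rate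
  (\<open>quadratic_recursion_bound\<close>).  The level \<open>\<mu> = 0\<close> needs another argument, since the term \<open>\<beta> g\<close> of the
  recursion does not vanish with \<open>\<mu>\<close>.  It is admissible only if \<open>\<delta> = 0\<close>, which forces all noise to
  vanish.  Then every node performs exact gradient descent on \<open>F\<close>, the new server iterate is a convex
  combination of the local results, and \<open>g\<^sub>t\<^sub>+\<^sub>1 \<le> g\<^sub>t - A g\<^sub>t\<^sup>2\<close> holds without any linear term
  (\<open>noiseless_descent\<close>).
\<close>

section \<open>Smooth convex functions\<close>

lemma GDERIV_unique:
  fixes f :: "'a::real_inner \<Rightarrow> real"
  assumes "GDERIV f x :> D" "GDERIV f x :> E"
  shows "D = E"
proof -
  have "(\<lambda>h. h \<bullet> D) = (\<lambda>h. h \<bullet> E)"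
    using assms unfolding gderiv_def by (rule has_derivative_unique)
  then have "(D - E) \<bullet> D = (D - E) \<bullet> E"
    by metis
  then show ?thesis
    by (metis eq_iff_diff_eq_0 inner_diff_right inner_eq_zero_iff)
qed

lemma gradient_eqI: "GDERIV f x :> D \<Longrightarrow> gradient f x = D"
  unfolding gradient_def by (blast intro: GDERIV_unique)

lemma GDERIV_gradient:
  fixes f :: "'a::euclidean_space \<Rightarrow> real"
  assumes "f differentiable (at x)"
  shows "GDERIV f x :> gradient f x"
proof -
  obtain f' where f': "(f has_derivative f') (at x)"
    using assms by (auto simp: differentiable_def)
  interpret f': bounded_linear f'
    using f' by (rule has_derivative_bounded_linear)
  define D where "D = (\<Sum>e\<in>Basis. f' e *\<^sub>R e)"
  have "f' h = h \<bullet> D" for h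
  proof -
    have "f' h = f' (\<Sum>e\<in>Basis. (h \<bullet> e) *\<^sub>R e)"
      by (simp add: euclidean_representation)
    also have "\<dots> = (\<Sum>e\<in>Basis. (h \<bullet> e) * f' e)"
      by (simp add: f'.sum f'.scaleR)
    also have "\<dots> = h \<bullet> D"
      by (simp add: D_def inner_sum_right mult.commute)
    finally show ?thesis .
  qed
  then have "f' = (\<lambda>h. h \<bullet> D)"
    by (rule ext)
  with f' have "GDERIV f x :> D"
    by (simp add: gderiv_def)
  then show ?thesis
    using gradient_eqI by metis
qed

lemma L_smooth_GDERIV: "L_smooth L f \<Longrightarrow> GDERIV f x :> gradient f x"
  by (simp add: L_smooth_def GDERIV_gradient)

lemma L_smooth_gradient_diff:
  "L_smooth L f \<Longrightarrow> norm (gradient f x - gradient f z) \<le> L * norm (x - z)"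
  by (auto simp: L_smooth_def lipschitz_on_def dist_norm)

lemma L_smooth_continuous: "L_smooth L f \<Longrightarrow> continuous_on UNIV f"
  by (auto simp: L_smooth_def intro!: continuous_at_imp_continuous_on differentiable_imp_continuous_within)

lemma L_smooth_continuous_gradient: "L_smooth L f \<Longrightarrow> continuous_on UNIV (gradient f)"
  by (auto simp: L_smooth_def intro: lipschitz_on_continuous_on)

lemma L_smooth_mean:
  fixes f :: "'i \<Rightarrow> 'a::euclidean_space \<Rightarrow> real"
  assumes "finite J" "J \<noteq> {}" and f: "\<And>j. j \<in> J \<Longrightarrow> L_smooth L (f j)"
  shows "L_smooth L (\<lambda>x. 1 / real (card J) * (\<Sum>j\<in>J. f j x))"
proof -
  define c where "c = 1 / real (card J)"
  define D where "D x = c *\<^sub>R (\<Sum>j\<in>J. gradient (f j) x)" for x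
  have c: "c \<ge> 0" "c * card J = 1"
    using assms by (auto simp: c_def)
  have "GDERIV (\<lambda>x. c * (\<Sum>j\<in>J. f j x)) x :> D x" for x
  proof -
    have "((\<lambda>x. c * (\<Sum>j\<in>J. f j x)) has_derivative (\<lambda>h. c * (\<Sum>j\<in>J. h \<bullet> gradient (f j) x))) (at x)"
      using L_smooth_GDERIV[OF f] unfolding gderiv_def
      by (intro has_derivative_mult_right has_derivative_sum) blast
    then show ?thesis
      by (simp add: gderiv_def D_def inner_sum_right)
  qed
  then have 1: "gradient (\<lambda>x. c * (\<Sum>j\<in>J. f j x)) = D"
    and 2: "(\<lambda>x. c * (\<Sum>j\<in>J. f j x)) differentiable (at x)" for x
    by (auto simp: gradient_eqI gderiv_def differentiable_def)
  obtain j where "j \<in> J"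
    using assms by blast
  then have "L \<ge> 0"
    using f[of j] by (auto simp: L_smooth_def lipschitz_on_def)
  moreover have "norm (D x - D z) \<le> L * norm (x - z)" for x z
  proof -
    have "norm (D x - D z) = c * norm (\<Sum>j\<in>J. gradient (f j) x - gradient (f j) z)"
      using c by (simp add: D_def sum_subtractf flip: scaleR_right_diff_distrib)
    also have "\<dots> \<le> c * (\<Sum>j\<in>J. L * norm (x - z))"
      using c L_smooth_gradient_diff[OF f] by (intro mult_left_mono sum_norm_le) auto
    also have "\<dots> = (c * card J) * (L * norm (x - z))"
      by simp
    finally show ?thesis
      using c by simp
  qed
  ultimately show ?thesis
    unfolding L_smooth_def lipschitz_on_def c_def[symmetric] 1 using 2 by (auto simp: dist_norm)
qed

lemma convex_on_mean:
  fixes f :: "'i \<Rightarrow> 'a::euclidean_space \<Rightarrow> real"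
  assumes "finite J" "J \<noteq> {}" "\<And>j. j \<in> J \<Longrightarrow> convex_on UNIV (f j)"
  shows "convex_on UNIV (\<lambda>x. 1 / real (card J) * (\<Sum>j\<in>J. f j x))"
proof (rule convex_on_cmul)
  show "convex_on UNIV (\<lambda>x. \<Sum>j\<in>J. f j x)"
    using assms by (induction rule: finite_ne_induct) (auto intro: convex_on_add)
qed simp

lemma has_derivative_along_line:
  fixes f :: "'a::euclidean_space \<Rightarrow> real"
  assumes "L_smooth L f"
  shows "((\<lambda>s. f (x + s *\<^sub>R d)) has_real_derivative (gradient f (x + s *\<^sub>R d) \<bullet> d)) (at s)"
proof -
  have 1: "(f has_derivative (\<lambda>h. h \<bullet> gradient f (x + s *\<^sub>R d))) (at (x + s *\<^sub>R d))"
    using L_smooth_GDERIV[OF assms] by (simp add: gderiv_def)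
  have 2: "((\<lambda>s. x + s *\<^sub>R d) has_derivative (\<lambda>h. h *\<^sub>R d)) (at s)"
    by (auto intro!: derivative_eq_intros)
  from has_derivative_compose[OF 2 1] show ?thesis
    by (simp add: has_field_derivative_def inner_commute[of d] mult.commute[of _ "_ \<bullet> d"])
qed

lemma L_smooth_descent:
  fixes f :: "'a::euclidean_space \<Rightarrow> real"
  assumes "L_smooth L f"
  shows "f (x + d) \<le> f x + gradient f x \<bullet> d + L / 2 * (norm d)\<^sup>2"
proof -
  define p where "p s = f (x + s *\<^sub>R d) - s * (gradient f x \<bullet> d) - L / 2 * s\<^sup>2 * (norm d)\<^sup>2" for s
  have "p 1 \<le> p 0"
  proof (rule DERIV_nonpos_imp_nonincreasing[where f = p])
    fix s :: real
    assume s: "0 \<le> s" "s \<le> 1"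
    let ?D = "gradient f (x + s *\<^sub>R d) \<bullet> d - gradient f x \<bullet> d - L * s * (norm d)\<^sup>2"
    have "(p has_real_derivative ?D) (at s)"
      unfolding p_def
      by (rule DERIV_diff has_derivative_along_line[OF assms])+
        (auto intro!: derivative_eq_intros)
    moreover have "(gradient f (x + s *\<^sub>R d) - gradient f x) \<bullet> d \<le> L * s * (norm d)\<^sup>2"
    proof -
      have "(gradient f (x + s *\<^sub>R d) - gradient f x) \<bullet> d
          \<le> norm (gradient f (x + s *\<^sub>R d) - gradient f x) * norm d"
        by (rule norm_cauchy_schwarz)
      also have "\<dots> \<le> (L * norm (s *\<^sub>R d)) * norm d"
        using L_smooth_gradient_diff[OF assms, of "x + s *\<^sub>R d" x] by (intro mult_right_mono) auto
      finally show ?thesis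
        using s by (simp add: power2_eq_square mult_ac)
    qed
    then have "?D \<le> 0"
      by (simp add: inner_diff_left)
    ultimately show "\<exists>D. (p has_real_derivative D) (at s) \<and> D \<le> 0"
      by blast
  qed simp
  then show ?thesis
    by (simp add: p_def)
qed

lemma convex_gradient_lower_bound:
  fixes f :: "'a::euclidean_space \<Rightarrow> real"
  assumes "L_smooth L f" "convex_on UNIV f"
  shows "f x + gradient f x \<bullet> d \<le> f (x + d)"
proof -
  have "convex_on UNIV (\<lambda>s. f (x + s *\<^sub>R d))"
  proof (rule convex_onI)
    fix t a c :: real
    assume "0 < t" "t < 1"
    then have "f ((1 - t) *\<^sub>R (x + a *\<^sub>R d) + t *\<^sub>R (x + c *\<^sub>R d))
        \<le> (1 - t) * f (x + a *\<^sub>R d) + t * f (x + c *\<^sub>R d)"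
      using assms(2) by (intro convex_onD) auto
    moreover have "(1 - t) *\<^sub>R (x + a *\<^sub>R d) + t *\<^sub>R (x + c *\<^sub>R d)
        = x + ((1 - t) *\<^sub>R a + t *\<^sub>R c) *\<^sub>R d"
      by (simp add: algebra_simps)
    ultimately show "f (x + ((1 - t) *\<^sub>R a + t *\<^sub>R c) *\<^sub>R d)
        \<le> (1 - t) * f (x + a *\<^sub>R d) + t * f (x + c *\<^sub>R d)"
      by simp
  qed simp
  from convex_on_imp_above_tangent[OF this, of 0 1 "gradient f x \<bullet> d"]
  show ?thesis
    using has_derivative_along_line[OF assms(1), of x d 0] by simp
qed

text \<open>A gradient step of length \<open>1 / L\<close> cannot go below the minimum.\<close>

lemma norm_gradient_le_gap:
  fixes f :: "'a::euclidean_space \<Rightarrow> real"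
  assumes "L_smooth L f" "0 < L" "\<And>z. f xs \<le> f z"
  shows "(norm (gradient f x))\<^sup>2 \<le> 2 * L * (f x - f xs)"
proof -
  have "f xs \<le> f (x + (- (1 / L)) *\<^sub>R gradient f x)"
    by (rule assms)
  also have "\<dots> \<le> f x - (norm (gradient f x))\<^sup>2 / (2 * L)"
  proof -
    let ?d = "(- (1 / L)) *\<^sub>R gradient f x"
    have "gradient f x \<bullet> ?d + L / 2 * (norm ?d)\<^sup>2 = - ((norm (gradient f x))\<^sup>2 / (2 * L))"
      using assms(2) by (simp add: dot_square_norm) (simp add: field_simps power2_eq_square)
    then show ?thesis
      using L_smooth_descent[OF assms(1), of x ?d] by linarith
  qed
  finally show ?thesis
    using assms(2) by (simp add: field_simps)
qed

lemma gap_le_norm_gradient: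
  fixes f :: "'a::euclidean_space \<Rightarrow> real"
  assumes "L_smooth L f" "convex_on UNIV f" "norm (x - xs) \<le> R"
  shows "f x - f xs \<le> R * norm (gradient f x)"
proof -
  have "f x - f xs \<le> gradient f x \<bullet> (x - xs)"
    using convex_gradient_lower_bound[OF assms(1,2), of x "xs - x"] by (simp add: inner_diff_right)
  also have "\<dots> \<le> norm (gradient f x) * norm (x - xs)"
    by (rule norm_cauchy_schwarz)
  also have "\<dots> \<le> norm (gradient f x) * R"
    using assms by (intro mult_left_mono) auto
  finally show ?thesis
    by (simp add: mult.commute)
qed

section \<open>Deterministic estimates for one round\<close>

lemma norm_add_squared_le:
  fixes a c :: "'a::real_inner"
  shows "(norm (a + c))\<^sup>2 \<le> 2 * (norm a)\<^sup>2 + 2 * (norm c)\<^sup>2"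
proof -
  have "(norm (a + c))\<^sup>2 + (norm (a - c))\<^sup>2 = 2 * (norm a)\<^sup>2 + 2 * (norm c)\<^sup>2"
    by (simp add: power2_norm_eq_inner inner_add inner_diff inner_commute)
  then show ?thesis
    by (smt (verit) zero_le_power2)
qed

lemma norm_sum_squared_le:
  fixes a :: "'i \<Rightarrow> 'a::real_inner"
  shows "(norm (\<Sum>k\<in>K. a k))\<^sup>2 \<le> card K * (\<Sum>k\<in>K. (norm (a k))\<^sup>2)"
proof -
  have "(norm (\<Sum>k\<in>K. a k))\<^sup>2 \<le> (\<Sum>k\<in>K. 1 * norm (a k))\<^sup>2"
    by (intro power_mono) (auto intro: sum_norm_le)
  also have "\<dots> \<le> (\<Sum>k\<in>K. 1\<^sup>2) * (\<Sum>k\<in>K. (norm (a k))\<^sup>2)"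
    by (rule Cauchy_Schwarz_ineq_sum)
  finally show ?thesis
    by simp
qed

lemma norm_mean_squared_le:
  fixes a :: "'i \<Rightarrow> 'a::real_inner"
  assumes "finite K" "K \<noteq> {}"
  shows "(norm ((1 / real (card K)) *\<^sub>R (\<Sum>k\<in>K. a k)))\<^sup>2 \<le> 1 / real (card K) * (\<Sum>k\<in>K. (norm (a k))\<^sup>2)"
proof -
  have c: "real (card K) > 0"
    using assms by (simp add: card_gt_0_iff)
  have "(norm ((1 / real (card K)) *\<^sub>R (\<Sum>k\<in>K. a k)))\<^sup>2 = (1 / real (card K))\<^sup>2 * (norm (\<Sum>k\<in>K. a k))\<^sup>2"
    by (simp add: power_mult_distrib power_divide)
  also have "\<dots> \<le> (1 / real (card K))\<^sup>2 * (card K * (\<Sum>k\<in>K. (norm (a k))\<^sup>2))"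
    by (intro mult_left_mono norm_sum_squared_le) auto
  also have "\<dots> = 1 / real (card K) * (\<Sum>k\<in>K. (norm (a k))\<^sup>2)"
    using c by (simp add: power2_eq_square)
  finally show ?thesis .
qed

lemma sum_lessThan_le_half_square: "(\<Sum>l<n. real l) \<le> (real n)\<^sup>2 / 2"
  by (induction n) (auto simp: power2_eq_square field_simps)

text \<open>The drift of the local iterates appears on both sides of the estimate that sums the local
  steps; the step size is small enough for half of it to be absorbed.\<close>

lemma local_drift:
  fixes f :: "'a::euclidean_space \<Rightarrow> real" and y \<xi> :: "nat \<Rightarrow> 'a"
  assumes f: "L_smooth L f" and L: "0 < L"
    and y_0: "y 0 = x"
    and y_Suc: "\<And>l. l < H \<Longrightarrow> y (Suc l) = y l - \<eta> *\<^sub>R (gradient f (y l) + \<xi> l)"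
    and \<eta>: "0 \<le> \<eta>" "\<eta> * L * real H \<le> 1 / 2"
  shows "(\<Sum>l<H. (norm (y l - x))\<^sup>2)
    \<le> 4 * \<eta>\<^sup>2 * real H ^ 3 * (norm (gradient f x))\<^sup>2 + 4 * \<eta>\<^sup>2 * (\<Sum>l<H. (norm (\<Sum>k<l. \<xi> k))\<^sup>2)"
proof -
  define S where "S = (\<Sum>l<H. (norm (y l - x))\<^sup>2)"
  define G where "G = (norm (gradient f x))\<^sup>2"
  define N where "N l = (norm (\<Sum>k<l. \<xi> k))\<^sup>2" for l
  have grad: "(norm (gradient f (y k)))\<^sup>2 \<le> 2 * G + 2 * L\<^sup>2 * (norm (y k - x))\<^sup>2" for k
  proof -
    have "(norm (gradient f (y k) - gradient f x))\<^sup>2 \<le> (L * norm (y k - x))\<^sup>2"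
      using L_smooth_gradient_diff[OF f] by (intro power_mono) auto
    then show ?thesis
      using norm_add_squared_le[of "gradient f x" "gradient f (y k) - gradient f x"]
      by (simp add: G_def power_mult_distrib)
  qed
  have y_diff: "y l - x = - (\<eta> *\<^sub>R ((\<Sum>k<l. gradient f (y k)) + (\<Sum>k<l. \<xi> k)))" if "l \<le> H" for l
    using that
  proof (induction l)
    case 0
    then show ?case
      by (simp add: y_0)
  next
    case (Suc l)
    then show ?case
      by (simp add: y_Suc algebra_simps)
  qed
  have "(norm (y l - x))\<^sup>2 \<le> 2 * \<eta>\<^sup>2 * (real l * (2 * real H * G + 2 * L\<^sup>2 * S)) + 2 * \<eta>\<^sup>2 * N l"
    if l: "l < H" for l
  proof -
    have "(norm (\<Sum>k<l. gradient f (y k)))\<^sup>2 \<le> real l * (\<Sum>k<l. (norm (gradient f (y k)))\<^sup>2)"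
      using norm_sum_squared_le[of "\<lambda>k. gradient f (y k)" "{..<l}"] by simp
    also have "\<dots> \<le> real l * (\<Sum>k<H. (norm (gradient f (y k)))\<^sup>2)"
      using l by (intro mult_left_mono sum_mono2) auto
    also have "\<dots> \<le> real l * (\<Sum>k<H. 2 * G + 2 * L\<^sup>2 * (norm (y k - x))\<^sup>2)"
      by (intro mult_left_mono sum_mono grad) auto
    also have "\<dots> = real l * (2 * real H * G + 2 * L\<^sup>2 * S)"
      by (simp add: sum.distrib S_def sum_distrib_left)
    finally have *: "(norm (\<Sum>k<l. gradient f (y k)))\<^sup>2 \<le> real l * (2 * real H * G + 2 * L\<^sup>2 * S)" .
    have "(norm (y l - x))\<^sup>2 = \<eta>\<^sup>2 * (norm ((\<Sum>k<l. gradient f (y k)) + (\<Sum>k<l. \<xi> k)))\<^sup>2"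
      using l by (simp add: y_diff power_mult_distrib)
    also have "\<dots> \<le> \<eta>\<^sup>2 * (2 * (norm (\<Sum>k<l. gradient f (y k)))\<^sup>2 + 2 * N l)"
      unfolding N_def by (intro mult_left_mono norm_add_squared_le) auto
    also have "\<dots> \<le> \<eta>\<^sup>2 * (2 * (real l * (2 * real H * G + 2 * L\<^sup>2 * S)) + 2 * N l)"
      using * by (intro mult_left_mono add_mono) auto
    finally show ?thesis
      by (simp add: algebra_simps)
  qed
  then have "S \<le> (\<Sum>l<H. 2 * \<eta>\<^sup>2 * (real l * (2 * real H * G + 2 * L\<^sup>2 * S)) + 2 * \<eta>\<^sup>2 * N l)"
    unfolding S_def by (intro sum_mono) auto
  also have "\<dots> = 2 * \<eta>\<^sup>2 * ((\<Sum>l<H. real l) * (2 * real H * G + 2 * L\<^sup>2 * S)) + 2 * \<eta>\<^sup>2 * (\<Sum>l<H. N l)"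
    by (simp add: sum.distrib sum_distrib_left sum_distrib_right)
  also have "\<dots> \<le> 2 * \<eta>\<^sup>2 * ((real H)\<^sup>2 / 2 * (2 * real H * G + 2 * L\<^sup>2 * S)) + 2 * \<eta>\<^sup>2 * (\<Sum>l<H. N l)"
    by (intro add_right_mono mult_left_mono mult_right_mono sum_lessThan_le_half_square)
      (auto simp: G_def S_def intro!: add_nonneg_nonneg mult_nonneg_nonneg sum_nonneg)
  also have "\<dots> = 2 * \<eta>\<^sup>2 * real H ^ 3 * G + 2 * (\<eta> * L * real H)\<^sup>2 * S + 2 * \<eta>\<^sup>2 * (\<Sum>l<H. N l)"
    by (simp add: algebra_simps power2_eq_square power3_eq_cube)
  also have "\<dots> \<le> 2 * \<eta>\<^sup>2 * real H ^ 3 * G + 2 * (1 / 2)\<^sup>2 * S + 2 * \<eta>\<^sup>2 * (\<Sum>l<H. N l)"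
    using \<eta> L by (intro add_mono mult_right_mono mult_left_mono power_mono) (auto simp: S_def intro!: sum_nonneg)
  finally have "S \<le> 4 * \<eta>\<^sup>2 * real H ^ 3 * G + 4 * \<eta>\<^sup>2 * (\<Sum>l<H. N l)"
    by (simp add: power2_eq_square)
  then show ?thesis
    unfolding S_def G_def N_def .
qed

text \<open>The server step \<open>s\<close> does at least as well, in the model with gradient \<open>q\<close> and curvature
  \<open>\<Lambda>\<close>, as the plain step \<open>- (\<theta> / L) q\<close> produced by uniform weights.  The margin \<open>\<Lambda> - L\<close> between
  the curvature of the model and that of the objective absorbs the error of \<open>q\<close>.\<close>

lemma model_step_descent:
  fixes f :: "'a::euclidean_space \<Rightarrow> real"
  assumes f: "L_smooth L f" and L: "0 < L" "L < \<Lambda>" and \<theta>: "0 < \<theta>" "\<Lambda> * \<theta> \<le> L / 2"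
    and opt: "q \<bullet> s + \<Lambda> / 2 * (norm s)\<^sup>2 \<le> q \<bullet> s0 + \<Lambda> / 2 * (norm s0)\<^sup>2"
    and s0: "s0 = - ((\<theta> / L) *\<^sub>R q)"
  shows "f (x + s) \<le> f x - \<theta> / (4 * L) * (norm (gradient f x))\<^sup>2
    + (\<theta> / (2 * L) + 1 / (2 * (\<Lambda> - L))) * (norm (gradient f x - q))\<^sup>2"
proof -
  define d where "d = gradient f x - q"
  have d_s: "d \<bullet> s \<le> 1 / (2 * (\<Lambda> - L)) * (norm d)\<^sup>2 + (\<Lambda> - L) / 2 * (norm s)\<^sup>2"
  proof -
    have "0 \<le> (norm (d - (\<Lambda> - L) *\<^sub>R s))\<^sup>2"
      by simp
    also have "\<dots> = (norm d)\<^sup>2 - 2 * (\<Lambda> - L) * (d \<bullet> s) + (\<Lambda> - L)\<^sup>2 * (norm s)\<^sup>2"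
      unfolding power2_norm_eq_inner by (simp add: inner_diff inner_commute power2_eq_square algebra_simps)
    finally show ?thesis
      using L by (simp add: field_simps power2_eq_square)
  qed
  have "q \<bullet> s0 + \<Lambda> / 2 * (norm s0)\<^sup>2 = - (\<theta> / L) * (1 - \<Lambda> * \<theta> / (2 * L)) * (norm q)\<^sup>2"
    using L unfolding s0 by (simp add: dot_square_norm power_mult_distrib power_divide) (simp add: field_simps power2_eq_square)
  also have "\<dots> \<le> - (\<theta> / L) * (1 / 2) * (norm q)\<^sup>2"
  proof (intro mult_right_mono mult_left_mono_neg)
    show "1 / 2 \<le> 1 - \<Lambda> * \<theta> / (2 * L)"
      using L \<theta> by (simp add: field_simps)
  qed (use L \<theta> in auto)
  finally have uniform: "q \<bullet> s0 + \<Lambda> / 2 * (norm s0)\<^sup>2 \<le> - (\<theta> / (2 * L)) * (norm q)\<^sup>2"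
    by simp
  have "(norm (gradient f x))\<^sup>2 \<le> 2 * (norm d)\<^sup>2 + 2 * (norm q)\<^sup>2"
    using norm_add_squared_le[of d q] by (simp add: d_def)
  then have "\<theta> / (2 * L) * ((norm (gradient f x))\<^sup>2 / 2 - (norm d)\<^sup>2) \<le> \<theta> / (2 * L) * (norm q)\<^sup>2"
    using L \<theta> by (intro mult_left_mono) auto
  then have q: "- (\<theta> / (2 * L)) * (norm q)\<^sup>2 \<le> - (\<theta> / (4 * L)) * (norm (gradient f x))\<^sup>2 + \<theta> / (2 * L) * (norm d)\<^sup>2"
    by (simp add: algebra_simps)
  have "f (x + s) \<le> f x + gradient f x \<bullet> s + L / 2 * (norm s)\<^sup>2"
    by (rule L_smooth_descent[OF f])
  also have "\<dots> = f x + (q \<bullet> s + \<Lambda> / 2 * (norm s)\<^sup>2) + d \<bullet> s - (\<Lambda> - L) / 2 * (norm s)\<^sup>2"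
    by (simp add: d_def inner_diff_left algebra_simps diff_divide_distrib)
  also have "\<dots> \<le> f x + (- (\<theta> / (4 * L)) * (norm (gradient f x))\<^sup>2 + \<theta> / (2 * L) * (norm d)\<^sup>2)
      + 1 / (2 * (\<Lambda> - L)) * (norm d)\<^sup>2"
    using opt uniform q d_s by linarith
  finally show ?thesis
    by (simp add: d_def algebra_simps)
qed

lemma A_hom_bounds:
  assumes "0 < L" "0 < R" "0 < \<theta>"
  shows "0 < A_hom L R \<theta>" "A_hom L R \<theta> \<le> \<theta> / (4 * L * R\<^sup>2)"
  using assms by (auto simp: A_hom_def intro!: divide_left_mono divide_pos_pos mult_pos_pos)

text \<open>Local gradient descent without noise.  The constant of \<^const>\<open>A_hom\<close> is far from optimal
  here: if the gap does not already shrink by a constant factor, it stays comparable to its initial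
  value throughout, and this bounds every gradient along the way from below.\<close>

lemma exact_local_descent:
  fixes f :: "'a::euclidean_space \<Rightarrow> real" and y :: "nat \<Rightarrow> 'a"
  assumes f: "L_smooth L f" "convex_on UNIV f" "\<And>z. f xs \<le> f z"
    and L: "0 < L" and R: "0 < R" and H: "0 < H" and \<theta>: "0 < \<theta>" "\<theta> \<le> 1 / 2"
    and y_Suc: "\<And>l. l < H \<Longrightarrow> y (Suc l) = y l - (\<theta> / (L * real H)) *\<^sub>R gradient f (y l)"
    and ball: "\<And>l. l \<le> H \<Longrightarrow> y l \<in> cball xs R"
  shows "f (y H) - f xs \<le> (f (y 0) - f xs) - A_hom L R \<theta> * (f (y 0) - f xs)\<^sup>2"
proof -
  define \<eta> where "\<eta> = \<theta> / (L * real H)"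
  define h where "h l = f (y l) - f xs" for l
  have \<eta>: "0 < \<eta>" "L * \<eta> \<le> 1 / 2"
  proof -
    have "\<theta> \<le> real H / 2"
      using \<theta> H by (simp add: order_trans[of \<theta> "1 / 2"] Suc_le_eq)
    then have "\<theta> / real H \<le> 1 / 2"
      using H by (simp add: pos_divide_le_eq)
    then show "L * \<eta> \<le> 1 / 2"
      using L by (simp add: \<eta>_def)
    show "0 < \<eta>"
      using L H \<theta> by (simp add: \<eta>_def)
  qed
  have h_nonneg: "0 \<le> h l" for l
    using f(3) by (simp add: h_def)
  have h_grad: "(h l)\<^sup>2 \<le> R\<^sup>2 * (norm (gradient f (y l)))\<^sup>2" if "l \<le> H" for l
  proof -
    have "h l \<le> R * norm (gradient f (y l))"
      unfolding h_def using ball[OF that]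
      by (intro gap_le_norm_gradient[OF f(1,2)]) (simp add: dist_norm norm_minus_commute)
    then have "(h l)\<^sup>2 \<le> (R * norm (gradient f (y l)))\<^sup>2"
      using h_nonneg by (intro power_mono)
    then show ?thesis
      by (simp add: power_mult_distrib)
  qed
  have h_step: "h (Suc l) \<le> h l - 3 * \<eta> / (4 * R\<^sup>2) * (h l)\<^sup>2" if l: "l < H" for l
  proof -
    let ?G = "norm (gradient f (y l))"
    have "h (Suc l) \<le> h l + (- \<eta> * ?G\<^sup>2 + L / 2 * (\<eta> * ?G)\<^sup>2)"
      using L_smooth_descent[OF f(1), of "y l" "- (\<eta> *\<^sub>R gradient f (y l))"] y_Suc[OF l] \<eta>(1)
      by (simp add: h_def \<eta>_def[symmetric] dot_square_norm)
    also have "- \<eta> * ?G\<^sup>2 + L / 2 * (\<eta> * ?G)\<^sup>2 = (L * \<eta> / 2 - 1) * (\<eta> * ?G\<^sup>2)"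
      by (simp add: power2_eq_square algebra_simps)
    also have "\<dots> \<le> - (3 / 4) * (\<eta> * ?G\<^sup>2)"
      using \<eta> by (intro mult_right_mono) auto
    also have "\<dots> \<le> - (3 / 4) * (\<eta> * ((h l)\<^sup>2 / R\<^sup>2))"
      using h_grad[of l] l \<eta> R by (intro mult_left_mono_neg mult_left_mono) (auto simp: field_simps)
    finally show ?thesis
      by simp
  qed
  define c where "c = 3 * \<eta> / (4 * R\<^sup>2)"
  have c: "0 < c"
    using \<eta> R by (simp add: c_def)
  have h_decr: "h k \<le> h l" if "l \<le> k" "k \<le> H" for k l
    using that
  proof (induction k rule: dec_induct)
    case (step k)
    then show ?case
      using h_step[of k] c unfolding c_def[symmetric]
      by (smt (verit) Suc_le_lessD less_imp_le_nat mult_nonneg_nonneg zero_le_power2)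
  qed simp
  have "h l \<le> h 0 - real l * (c * (h H)\<^sup>2)" if "l \<le> H" for l
    using that
  proof (induction l)
    case (Suc l)
    have "c * (h H)\<^sup>2 \<le> c * (h l)\<^sup>2"
      using c h_nonneg h_decr[of l H] Suc by (intro mult_left_mono power_mono) auto
    then show ?case
      using h_step[of l] Suc unfolding c_def[symmetric] by (simp add: algebra_simps)
  qed simp
  from this[of H] have main: "h H \<le> h 0 - 3 * \<theta> / (4 * L * R\<^sup>2) * (h H)\<^sup>2"
    using H by (simp add: c_def \<eta>_def)
  have A: "A_hom L R \<theta> \<le> \<theta> / (4 * L * R\<^sup>2)" "0 < A_hom L R \<theta>"
    using A_hom_bounds[OF L R \<theta>(1)] by simp_all
  show ?thesis
    \<comment> \<open>The constant needs \<open>(3 / 5)\<^sup>2 \<ge> 1 / 3\<close> in one case and \<open>3 / 5 \<le> 1 - 1 / 8\<close> in the other.\<close>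
  proof (cases "h H \<le> 3 / 5 * h 0")
    case True
    have "gradient f xs = 0"
      using norm_gradient_le_gap[OF f(1) L f(3), of xs] by simp
    then have "norm (gradient f (y 0)) \<le> L * norm (y 0 - xs)"
      using L_smooth_gradient_diff[OF f(1), of "y 0" xs] by simp
    also have "\<dots> \<le> L * R"
      using ball[of 0] L by (intro mult_left_mono) (auto simp: dist_norm norm_minus_commute)
    finally have "R * norm (gradient f (y 0)) \<le> R * (L * R)"
      using R by (intro mult_left_mono) auto
    moreover have "h 0 \<le> R * norm (gradient f (y 0))"
      unfolding h_def using ball[of 0]
      by (intro gap_le_norm_gradient[OF f(1,2)]) (simp add: dist_norm norm_minus_commute)
    ultimately have "h 0 \<le> L * R\<^sup>2"
      by (simp add: power2_eq_square mult_ac)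
    then have "A_hom L R \<theta> * h 0 \<le> \<theta> / (4 * L * R\<^sup>2) * (L * R\<^sup>2)"
      using A \<theta> L R h_nonneg by (intro mult_mono) auto
    also have "\<dots> \<le> 1 / 8"
      using \<theta> L R by simp
    finally have "A_hom L R \<theta> * h 0 * h 0 \<le> 1 / 8 * h 0"
      using h_nonneg by (intro mult_right_mono)
    then show ?thesis
      using True h_nonneg[of 0] unfolding h_def[symmetric] power2_eq_square by (simp add: mult.assoc)
  next
    case False
    then have "(3 / 5 * h 0)\<^sup>2 \<le> (h H)\<^sup>2"
      using h_nonneg[of 0] by (intro power_mono) auto
    moreover have "(h 0)\<^sup>2 / 3 \<le> (3 / 5 * h 0)\<^sup>2"
      by (simp add: power_mult_distrib power_divide)
    ultimately have "(h 0)\<^sup>2 / 3 \<le> (h H)\<^sup>2"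
      by linarith
    then have "3 * \<theta> / (4 * L * R\<^sup>2) * ((h 0)\<^sup>2 / 3) \<le> 3 * \<theta> / (4 * L * R\<^sup>2) * (h H)\<^sup>2"
      using \<theta> L R by (intro mult_left_mono) auto
    moreover have "A_hom L R \<theta> * (h 0)\<^sup>2 \<le> \<theta> / (4 * L * R\<^sup>2) * (h 0)\<^sup>2"
      using A by (intro mult_right_mono) auto
    ultimately show ?thesis
      using main unfolding h_def[symmetric] by simp
  qed
qed

section \<open>The scalar recursion\<close>

text \<open>A real sequence that satisfies \<open>e (t + 1) \<le> e t - A (e t)\<^sup>2\<close> as long as it is positive, and
  that stays nonpositive afterwards, decays like \<open>1 / (A t)\<close>.\<close>

lemma quadratic_recursion_bound:
  fixes e :: "nat \<Rightarrow> real"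
  assumes A: "0 \<le> A"
    and pos: "\<And>t. 0 < e t \<Longrightarrow> e (Suc t) \<le> e t - A * (e t)\<^sup>2"
    and nonpos: "\<And>t. e t \<le> 0 \<Longrightarrow> e (Suc t) \<le> 0"
  shows "ereal (e T) \<le> 1 / (inverse (ereal (max (e 0) 0)) + ereal (A * real T))"
proof (cases "e 0 \<le> 0")
  case True
  then have "e T \<le> 0"
    by (induction T) (auto intro: nonpos)
  then show ?thesis
    using True by (simp add: max_def)
next
  case False
  have "e T \<le> 1 / (1 / e 0 + A * real T)"
  proof (induction T)
    case (Suc T)
    let ?r = "1 / e 0 + A * real T"
    have r: "0 < ?r"
      using A False by (intro add_pos_nonneg) auto
    show ?case
    proof (cases "e T \<le> 0")
      case True
      have "0 \<le> 1 / (1 / e 0 + A * real (Suc T))"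
        using A False by auto
      then show ?thesis
        using nonpos[OF True] by linarith
    next
      case e: False
      have "e (Suc T) \<le> e T - A * (e T)\<^sup>2"
        using pos e by simp
      also have "\<dots> \<le> e T / (1 + A * e T)"
      proof -
        have "(e T - A * (e T)\<^sup>2) * (1 + A * e T) = e T - A\<^sup>2 * (e T) ^ 3"
          by (simp add: algebra_simps power2_eq_square power3_eq_cube)
        also have "\<dots> \<le> e T"
          using e by simp
        finally show ?thesis
          using e A by (subst pos_le_divide_eq) (auto intro: add_pos_nonneg)
      qed
      also have "\<dots> = 1 / (1 / e T + A)"
        using e by (simp add: field_simps)
      also have "\<dots> \<le> 1 / (?r + A)"
      proof -
        have "?r \<le> 1 / e T"
          using Suc r e by (simp add: field_simps)
        then show ?thesis
          using A r by (intro divide_left_mono mult_pos_pos) auto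
      qed
      finally show ?thesis
        by (simp add: algebra_simps)
    qed
  qed simp
  moreover have "0 < 1 / e 0 + A * real T"
    using A False by (intro add_pos_nonneg) auto
  ultimately show ?thesis
    using False by (simp add: max_def one_ereal_def inverse_eq_divide)
qed

text \<open>The excess over a level at which the quadratic is nonnegative obeys the recursion of the
  preceding lemma.  Positivity of \<open>\<mu>\<close> matters: it gives \<open>\<beta> \<le> A \<mu>\<close>, which cancels the linear growth.\<close>

lemma shifted_recursion:
  fixes u A \<beta> \<delta> \<mu> :: real
  assumes A: "0 < A" and nonneg: "0 \<le> \<beta>" "0 \<le> \<delta>" and \<mu>: "0 < \<mu>"
    and level: "A * \<mu>\<^sup>2 - \<beta> * \<mu> - \<delta> \<ge> 0" "2 * A * \<mu> \<le> 1 + \<beta>"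
    and rec: "v \<le> u - A * u\<^sup>2 + \<beta> * u + \<delta>"
  shows "0 < u - \<mu> \<Longrightarrow> v - \<mu> \<le> (u - \<mu>) - A * (u - \<mu>)\<^sup>2"
    and "u - \<mu> \<le> 0 \<Longrightarrow> v - \<mu> \<le> 0"
proof -
  have "\<beta> * \<mu> \<le> A * \<mu> * \<mu>"
    using level nonneg by (simp add: power2_eq_square mult.assoc)
  then have "\<beta> \<le> A * \<mu>"
    using \<mu> by (rule mult_right_le_imp_le)
  then have slope: "0 \<le> 1 + \<beta> - 2 * A * \<mu>" "1 + \<beta> - 2 * A * \<mu> \<le> 1"
    using level A \<mu> nonneg by auto
  have "v - \<mu> \<le> u - \<mu> - A * u\<^sup>2 + \<beta> * u + \<delta> + (A * \<mu>\<^sup>2 - \<beta> * \<mu> - \<delta>)"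
    using rec level by linarith
  also have "\<dots> = (1 + \<beta> - 2 * A * \<mu>) * (u - \<mu>) - A * (u - \<mu>)\<^sup>2"
    by (simp add: algebra_simps power2_eq_square)
  finally have *: "v - \<mu> \<le> (1 + \<beta> - 2 * A * \<mu>) * (u - \<mu>) - A * (u - \<mu>)\<^sup>2" .
  show "v - \<mu> \<le> (u - \<mu>) - A * (u - \<mu>)\<^sup>2" if "0 < u - \<mu>"
    using * mult_right_mono[OF slope(2) less_imp_le[OF that]] by simp
  show "v - \<mu> \<le> 0" if "u - \<mu> \<le> 0"
    using * mult_nonneg_nonpos[OF slope(1) that] A by (smt (verit) mult_nonneg_nonneg zero_le_power2)
qed

section \<open>Conditional independence and vanishing correlations\<close>

context prob_space
begin

lemma subalgebra_sigma_finite: "subalgebra M G \<Longrightarrow> sigma_finite_subalgebra M G"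
  by (intro finite_measure_subalgebra_is_sigma_finite finite_measure_subalgebra.intro
      finite_measure_subalgebra_axioms.intro) (rule finite_measure_axioms)

lemma integral_mult_cond_mean_zero:
  assumes G: "subalgebra M G" and Z: "Z \<in> borel_measurable G" and X: "X \<in> borel_measurable M"
    and "integrable M (\<lambda>\<omega>. Z \<omega> * X \<omega>)" and "AE \<omega> in M. real_cond_exp M G X \<omega> = 0"
  shows "(LINT \<omega>|M. Z \<omega> * X \<omega>) = 0"
proof -
  interpret G: sigma_finite_subalgebra M G
    using G by (rule subalgebra_sigma_finite)
  have [measurable]: "Z \<in> borel_measurable M"
    using G Z by (rule measurable_from_subalg)
  have "(LINT \<omega>|M. Z \<omega> * X \<omega>) = (LINT \<omega>|M. Z \<omega> * real_cond_exp M G X \<omega>)"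
    using assms by (simp add: G.real_cond_exp_intg(2))
  also have "\<dots> = (LINT \<omega>|M. 0)"
    using assms(5) by (intro integral_cong_AE) auto
  finally show ?thesis
    by simp
qed

text \<open>Events of the form \<open>C \<inter> P\<close> are an intersection-stable generator of the join of the
  sigma-algebra \<open>F\<close> and the system \<open>\<P>\<close>, so integrals only have to be compared there.\<close>

lemma integral_eq_on_join:
  fixes f h :: "'a \<Rightarrow> real"
  assumes F: "subalgebra M F"
    and P: "\<P> \<subseteq> sets M" "Int_stable \<P>" "space M \<in> \<P>"
    and int: "integrable M f" "integrable M h"
    and eq: "\<And>C P. C \<in> sets F \<Longrightarrow> P \<in> \<P> \<Longrightarrow>
      (LINT \<omega>|M. indicator (C \<inter> P) \<omega> * f \<omega>) = (LINT \<omega>|M. indicator (C \<inter> P) \<omega> * h \<omega>)"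
    and D: "D \<in> sigma_sets (space M) (sets F \<union> \<P>)"
  shows "(LINT \<omega>|M. indicator D \<omega> * f \<omega>) = (LINT \<omega>|M. indicator D \<omega> * h \<omega>)"
proof -
  define E where "E = {C \<inter> P | C P. C \<in> sets F \<and> P \<in> \<P>}"
  have F_sub: "sets F \<subseteq> sets M" "space F = space M"
    using F by (auto simp: subalgebra_def)
  have space_F: "space M \<in> sets F"
    using F_sub sets.top[of F] by simp
  have E_sub: "E \<subseteq> sets M"
    using F_sub P by (auto simp: E_def)
  then have E_Pow: "E \<subseteq> Pow (space M)"
    using sets.space_closed by (rule subset_trans)
  have E_Int: "Int_stable E"
  proof (rule Int_stableI)
    fix a c
    assume "a \<in> E" "c \<in> E"
    then obtain C P C' P' where *: "a = C \<inter> P" "c = C' \<inter> P'" "C \<in> sets F" "C' \<in> sets F" "P \<in> \<P>" "P' \<in> \<P>"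
      by (auto simp: E_def)
    then have "a \<inter> c = (C \<inter> C') \<inter> (P \<inter> P')" "C \<inter> C' \<in> sets F" "P \<inter> P' \<in> \<P>"
      using P(2) by (auto simp: Int_stable_def)
    then show "a \<inter> c \<in> E"
      unfolding E_def by blast
  qed
  have "sets F \<union> \<P> \<subseteq> E"
  proof
    fix a
    assume a: "a \<in> sets F \<union> \<P>"
    then have "a \<subseteq> space M"
      using F_sub P sets.sets_into_space by blast
    then have "a = a \<inter> space M" "a = space M \<inter> a"
      by auto
    with a show "a \<in> E"
      unfolding E_def using space_F P(3) by blast
  qed
  with D have D_E: "D \<in> sigma_sets (space M) E"
    using sigma_sets_mono' by blast
  have sets: "a \<in> sets M" if "a \<in> sigma_sets (space M) E" for a
    using that E_sub sets.sigma_sets_subset by blast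
  have int': "integrable M (\<lambda>\<omega>. indicator a \<omega> * f \<omega>)" "integrable M (\<lambda>\<omega>. indicator a \<omega> * h \<omega>)"
    if "a \<in> sets M" for a
    using integrable_mult_indicator[OF that int(1)] integrable_mult_indicator[OF that int(2)] by simp_all
  have total: "(LINT \<omega>|M. f \<omega>) = (LINT \<omega>|M. h \<omega>)"
  proof -
    have "(LINT \<omega>|M. indicator (space M \<inter> space M) \<omega> * f \<omega>) = (LINT \<omega>|M. f \<omega>)"
      "(LINT \<omega>|M. indicator (space M \<inter> space M) \<omega> * h \<omega>) = (LINT \<omega>|M. h \<omega>)"
      by (auto intro!: Bochner_Integration.integral_cong)
    then show ?thesis
      using eq[OF space_F P(3)] by simp
  qed
  show ?thesis
    using E_Int E_Pow D_E
  proof (induction D rule: sigma_sets_induct_disjoint)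
    case (basic a)
    then show ?case
      using eq by (auto simp: E_def)
  next
    case empty
    then show ?case
      by simp
  next
    case (compl a)
    have "(LINT \<omega>|M. indicator (space M - a) \<omega> * k \<omega>) = (LINT \<omega>|M. k \<omega>) - (LINT \<omega>|M. indicator a \<omega> * k \<omega>)"
      if "integrable M k" "integrable M (\<lambda>\<omega>. indicator a \<omega> * k \<omega>)" for k :: "'a \<Rightarrow> real"
    proof -
      have "(LINT \<omega>|M. indicator (space M - a) \<omega> * k \<omega>) = (LINT \<omega>|M. k \<omega> - indicator a \<omega> * k \<omega>)"
        by (intro Bochner_Integration.integral_cong) (auto simp: indicator_def)
      then show ?thesis
        using that by simp
    qed
    then show ?case
      using compl int int'[OF sets] total by simp
  next
    case (union a)
    have a: "\<And>i. a i \<in> sets M" "\<Union>(range a) \<in> sets M"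
      using sets union by auto
    have *: "set_lebesgue_integral M (\<Union>i. a i) k = (\<Sum>i. set_lebesgue_integral M (a i) k)"
      if "set_integrable M (\<Union>i. a i) k" for k :: "'a \<Rightarrow> real"
      using a union that by (intro lebesgue_integral_countable_add) (auto simp: disjoint_family_on_def)
    show ?case
      using *[of f] *[of h] int'[OF a(2)] union.IH
      by (simp add: set_lebesgue_integral_def set_integrable_def)
  qed
qed

text \<open>If \<open>\<P>\<close> and \<open>\<Q>\<close> are conditionally independent given \<open>F\<close>, then a variable that is computed from
  \<open>F\<close> and \<open>\<P>\<close> and has conditional mean zero given \<open>F\<close> keeps conditional mean zero when the
  information in \<open>\<Q>\<close> is added; so it is uncorrelated with every variable \<open>h\<close> computed from \<open>F\<close> and
  \<open>\<Q>\<close>.\<close>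

lemma cond_indep_integral_mult_zero:
  fixes f h :: "'a \<Rightarrow> real"
  assumes F: "subalgebra M F"
    and P: "\<P> \<subseteq> sets M" "Int_stable \<P>" "space M \<in> \<P>"
    and Q: "\<Q> \<subseteq> sets M" "Int_stable \<Q>" "space M \<in> \<Q>"
    and indep: "\<And>P Q. P \<in> \<P> \<Longrightarrow> Q \<in> \<Q> \<Longrightarrow> AE \<omega> in M.
      real_cond_exp M F (indicator (P \<inter> Q)) \<omega> = real_cond_exp M F (indicator P) \<omega> * real_cond_exp M F (indicator Q) \<omega>"
    and f: "f \<in> borel_measurable (sigma (space M) (sets F \<union> \<P>))" "integrable M f"
      "AE \<omega> in M. real_cond_exp M F f \<omega> = 0"
    and h: "h \<in> borel_measurable (sigma (space M) (sets F \<union> \<Q>))" "integrable M (\<lambda>\<omega>. h \<omega> * f \<omega>)"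
  shows "(LINT \<omega>|M. h \<omega> * f \<omega>) = 0"
proof -
  let ?A = "sigma (space M) (sets F \<union> \<P>)" and ?B = "sigma (space M) (sets F \<union> \<Q>)"
  interpret F: sigma_finite_subalgebra M F
    using F by (rule subalgebra_sigma_finite)
  have F_sub: "sets F \<subseteq> sets M" "space F = space M"
    using F by (auto simp: subalgebra_def)
  have sub: "sets F \<union> \<P> \<subseteq> sets M" "sets F \<union> \<Q> \<subseteq> sets M"
    using F_sub P Q by auto
  then have sets_AB: "sets ?A = sigma_sets (space M) (sets F \<union> \<P>)" "sets ?B = sigma_sets (space M) (sets F \<union> \<Q>)"
    using sets.space_closed[of M] by (auto intro!: sets_measure_of)
  have A: "subalgebra M ?A" and B: "subalgebra M ?B"
    using sub[THEN sets.sigma_sets_subset] by (simp_all add: subalgebra_def sets_AB space_measure_of_conv)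
  have F_A: "subalgebra ?A F"
    using F_sub by (auto simp: subalgebra_def sets_AB space_measure_of_conv)
  interpret A: sigma_finite_subalgebra M ?A
    using A by (rule subalgebra_sigma_finite)
  interpret B: sigma_finite_subalgebra M ?B
    using B by (rule subalgebra_sigma_finite)
  have [measurable]: "f \<in> borel_measurable M"
    using f by auto
  have int_ind: "integrable M (indicator a :: 'a \<Rightarrow> real)" if "a \<in> sets M" for a
    using that by (simp add: integrable_indicator_iff emeasure_eq_measure)
  have cond_Q: "AE \<omega> in M. real_cond_exp M ?A (indicator Q) \<omega> = real_cond_exp M F (indicator Q) \<omega>" if "Q \<in> \<Q>" for Q
  proof (rule A.real_cond_exp_charact)
    have [measurable]: "Q \<in> sets M"
      using that Q by auto
    let ?\<psi> = "real_cond_exp M F (indicator Q)"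
    show int: "integrable M (indicator Q :: 'a \<Rightarrow> real)" "integrable M ?\<psi>"
      using int_ind[of Q] F.real_cond_exp_int by auto
    show "?\<psi> \<in> borel_measurable ?A"
      using F_A by (rule measurable_from_subalg) simp
    fix D
    assume D: "D \<in> sets ?A"
    have "(LINT \<omega>|M. indicator D \<omega> * indicator Q \<omega>) = (LINT \<omega>|M. indicator D \<omega> * ?\<psi> \<omega>)"
    proof (rule integral_eq_on_join[OF F P int])
      show "D \<in> sigma_sets (space M) (sets F \<union> \<P>)"
        using D by (simp add: sets_AB)
      fix C R
      assume C: "C \<in> sets F" and R: "R \<in> \<P>"
      have [measurable]: "C \<in> sets M" "R \<in> sets M"
        using C R F_sub P by auto
      have C_F [measurable]: "(indicator C :: 'a \<Rightarrow> real) \<in> borel_measurable F"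
        using C by simp
      have 1: "integrable M (\<lambda>\<omega>. indicator C \<omega> * indicator (R \<inter> Q) \<omega> :: real)"
        using int_ind[of "C \<inter> (R \<inter> Q)"] by (simp add: indicator_inter_arith[abs_def])
      have 2: "integrable M (\<lambda>\<omega>. (indicator C \<omega> * ?\<psi> \<omega>) * indicator R \<omega>)"
        using integrable_mult_indicator[OF _ int(2), of "C \<inter> R"] by (simp add: indicator_inter_arith mult_ac)
      have "(LINT \<omega>|M. indicator (C \<inter> R) \<omega> * indicator Q \<omega> :: real) = (LINT \<omega>|M. indicator C \<omega> * indicator (R \<inter> Q) \<omega>)"
        by (simp add: indicator_inter_arith mult_ac)
      also have "\<dots> = (LINT \<omega>|M. indicator C \<omega> * real_cond_exp M F (indicator (R \<inter> Q)) \<omega>)"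
        using 1 by (simp add: F.real_cond_exp_intg(2))
      also have "\<dots> = (LINT \<omega>|M. (indicator C \<omega> * ?\<psi> \<omega>) * real_cond_exp M F (indicator R) \<omega>)"
        using indep[OF R that] by (intro integral_cong_AE) (auto simp: mult_ac)
      also have "\<dots> = (LINT \<omega>|M. (indicator C \<omega> * ?\<psi> \<omega>) * indicator R \<omega>)"
        using 2 by (intro F.real_cond_exp_intg(2)) auto
      also have "\<dots> = (LINT \<omega>|M. indicator (C \<inter> R) \<omega> * ?\<psi> \<omega>)"
        by (simp add: indicator_inter_arith mult_ac)
      finally show "(LINT \<omega>|M. indicator (C \<inter> R) \<omega> * indicator Q \<omega> :: real) = (LINT \<omega>|M. indicator (C \<inter> R) \<omega> * ?\<psi> \<omega>)" .
    qed
    then show "(LINT \<omega>:D|M. indicator Q \<omega>) = (LINT \<omega>:D|M. ?\<psi> \<omega>)"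
      by (simp add: set_lebesgue_integral_def)
  qed
  have zero: "(LINT \<omega>|M. indicator (C \<inter> Q) \<omega> * f \<omega>) = 0" if C: "C \<in> sets F" and Q': "Q \<in> \<Q>" for C Q
  proof -
    have [measurable]: "C \<in> sets M" "Q \<in> sets M"
      using C Q' F_sub Q by auto
    have C_F [measurable]: "(indicator C :: 'a \<Rightarrow> real) \<in> borel_measurable F"
      using C by simp
    let ?\<psi> = "real_cond_exp M F (indicator Q)"
    have C_f: "(\<lambda>\<omega>. indicator C \<omega> * f \<omega>) \<in> borel_measurable ?A"
      using f(1) measurable_from_subalg[OF F_A C_F] by (rule borel_measurable_times[rotated])
    have 1: "integrable M (\<lambda>\<omega>. (indicator C \<omega> * f \<omega>) * indicator Q \<omega>)"
      using integrable_mult_indicator[OF _ f(2), of "C \<inter> Q"] by (simp add: indicator_inter_arith mult_ac)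
    have 2: "AE \<omega> in M. (indicator C \<omega> * f \<omega>) * real_cond_exp M ?A (indicator Q) \<omega> = (indicator C \<omega> * ?\<psi> \<omega>) * f \<omega>"
      using cond_Q[OF Q'] by (auto simp: mult_ac)
    have 3: "integrable M (\<lambda>\<omega>. (indicator C \<omega> * ?\<psi> \<omega>) * f \<omega>)"
      using A.real_cond_exp_intg(1)[OF 1 C_f] 2
      by (subst integrable_cong_AE[symmetric, OF _ _ 2]) auto
    have "(LINT \<omega>|M. indicator (C \<inter> Q) \<omega> * f \<omega>) = (LINT \<omega>|M. (indicator C \<omega> * f \<omega>) * indicator Q \<omega>)"
      by (simp add: indicator_inter_arith mult_ac)
    also have "\<dots> = (LINT \<omega>|M. (indicator C \<omega> * f \<omega>) * real_cond_exp M ?A (indicator Q) \<omega>)"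
      using 1 C_f by (simp add: A.real_cond_exp_intg(2))
    also have "\<dots> = (LINT \<omega>|M. (indicator C \<omega> * ?\<psi> \<omega>) * f \<omega>)"
      using 2 by (intro integral_cong_AE) auto
    also have "\<dots> = 0"
      using 3 f(3) by (intro integral_mult_cond_mean_zero[OF F]) auto
    finally show ?thesis .
  qed
  have "AE \<omega> in M. real_cond_exp M ?B f \<omega> = 0"
  proof (rule B.real_cond_exp_charact)
    fix D
    assume "D \<in> sets ?B"
    then have "D \<in> sigma_sets (space M) (sets F \<union> \<Q>)"
      by (simp only: sets_AB)
    then have "(LINT \<omega>|M. indicator D \<omega> * f \<omega>) = (LINT \<omega>|M. indicator D \<omega> * 0)"
      by (rule integral_eq_on_join[OF F Q f(2) integrable_zero, rotated]) (simp add: zero)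
    then show "(LINT \<omega>:D|M. f \<omega>) = (LINT \<omega>:D|M. 0)"
      by (simp add: set_lebesgue_integral_def)
  qed (use f in auto)
  then show ?thesis
    using h by (intro integral_mult_cond_mean_zero[OF B]) auto
qed

text \<open>Pythagoras for pairwise uncorrelated vectors.\<close>

lemma integral_norm_sum_squared:
  fixes \<xi> :: "'i \<Rightarrow> 'a \<Rightarrow> 'b::euclidean_space" and c :: "'i \<Rightarrow> real"
  assumes "finite K"
    and int: "\<And>j k. j \<in> K \<Longrightarrow> k \<in> K \<Longrightarrow> integrable M (\<lambda>\<omega>. \<xi> j \<omega> \<bullet> \<xi> k \<omega>)"
    and orth: "\<And>j k. j \<in> K \<Longrightarrow> k \<in> K \<Longrightarrow> j \<noteq> k \<Longrightarrow> (LINT \<omega>|M. \<xi> j \<omega> \<bullet> \<xi> k \<omega>) = 0"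
  shows "integrable M (\<lambda>\<omega>. (norm (\<Sum>k\<in>K. c k *\<^sub>R \<xi> k \<omega>))\<^sup>2)"
    and "(LINT \<omega>|M. (norm (\<Sum>k\<in>K. c k *\<^sub>R \<xi> k \<omega>))\<^sup>2) = (\<Sum>k\<in>K. (c k)\<^sup>2 * (LINT \<omega>|M. (norm (\<xi> k \<omega>))\<^sup>2))"
proof -
  have eq: "(norm (\<Sum>k\<in>K. c k *\<^sub>R \<xi> k \<omega>))\<^sup>2 = (\<Sum>j\<in>K. \<Sum>k\<in>K. c j * c k * (\<xi> j \<omega> \<bullet> \<xi> k \<omega>))" for \<omega>
    unfolding power2_norm_eq_inner inner_sum_left by (simp add: inner_sum_right mult_ac)
  show "integrable M (\<lambda>\<omega>. (norm (\<Sum>k\<in>K. c k *\<^sub>R \<xi> k \<omega>))\<^sup>2)"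
    unfolding eq using int by auto
  have "(LINT \<omega>|M. (norm (\<Sum>k\<in>K. c k *\<^sub>R \<xi> k \<omega>))\<^sup>2) = (\<Sum>j\<in>K. \<Sum>k\<in>K. c j * c k * (LINT \<omega>|M. \<xi> j \<omega> \<bullet> \<xi> k \<omega>))"
    unfolding eq using int by (simp add: Bochner_Integration.integral_sum)
  also have "\<dots> = (\<Sum>j\<in>K. \<Sum>k\<in>K. if j = k then (c k)\<^sup>2 * (LINT \<omega>|M. (norm (\<xi> k \<omega>))\<^sup>2) else 0)"
    using orth by (intro sum.cong refl) (auto simp: power2_norm_eq_inner power2_eq_square[of "c _"])
  also have "\<dots> = (\<Sum>k\<in>K. (c k)\<^sup>2 * (LINT \<omega>|M. (norm (\<xi> k \<omega>))\<^sup>2))"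
    using assms(1) by (simp add: sum.delta)
  finally show "(LINT \<omega>|M. (norm (\<Sum>k\<in>K. c k *\<^sub>R \<xi> k \<omega>))\<^sup>2) = (\<Sum>k\<in>K. (c k)\<^sup>2 * (LINT \<omega>|M. (norm (\<xi> k \<omega>))\<^sup>2))" .
qed

lemma integral_squared_ge:
  fixes X :: "'a \<Rightarrow> real"
  assumes "integrable M X" "integrable M (\<lambda>\<omega>. (X \<omega>)\<^sup>2)"
  shows "(LINT \<omega>|M. X \<omega>)\<^sup>2 \<le> (LINT \<omega>|M. (X \<omega>)\<^sup>2)"
  using variance_positive[of X] variance_eq[OF assms] by simp

end

section \<open>Information and noise in the local steps\<close>

text \<open>The algorithm together with the hypotheses on the schedules.\<close>

locale curved_post_local =
  hom_post_local M m \<phi> L xstar R H b \<theta>lo \<theta>hi \<theta> \<Lambda> B g y x w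
  for M :: "'w measure"
    and m :: "'n::finite \<Rightarrow> nat"
    and \<phi> :: "'n \<Rightarrow> nat \<Rightarrow> 'a::euclidean_space \<Rightarrow> real"
    and L :: real and xstar :: 'a and R :: real
    and H :: "'n \<Rightarrow> nat" and b :: "'n \<Rightarrow> nat"
    and \<theta>lo \<theta>hi :: real and \<theta> \<Lambda> :: "nat \<Rightarrow> real"
    and B :: "'n \<Rightarrow> nat \<Rightarrow> nat \<Rightarrow> 'w \<Rightarrow> nat multiset"
    and g :: "'n \<Rightarrow> nat \<Rightarrow> nat \<Rightarrow> 'w \<Rightarrow> 'a"
    and y :: "'n \<Rightarrow> nat \<Rightarrow> nat \<Rightarrow> 'w \<Rightarrow> 'a"
    and x :: "nat \<Rightarrow> 'w \<Rightarrow> 'a"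
    and w :: "nat \<Rightarrow> 'w \<Rightarrow> real ^ 'n" +
  assumes curvature_le: "\<And>t. \<Lambda> t \<le> 2 * L"
    and curvature_amplitude: "\<And>t. \<Lambda> t * \<theta> t \<le> L / 2"
begin

abbreviation obj :: "'a \<Rightarrow> real" where
  "obj \<equiv> global_obj m \<phi>"

text \<open>The error of the stochastic gradient in one local step.\<close>

definition noise :: "'n \<Rightarrow> nat \<Rightarrow> nat \<Rightarrow> 'w \<Rightarrow> 'a" where
  "noise i t l \<omega> = g i t l \<omega> - gradient obj (y i t l \<omega>)"

lemma L_pos: "0 < L"
  using curvature[of 0] curvature_le[of 0] by linarith

lemma amplitude_pos: "0 < \<theta> t"
  using amplitude[of t] amplitude_bounds by auto

lemma amplitude_le_half: "\<theta> t \<le> 1 / 2"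
proof -
  have "L * \<theta> t \<le> \<Lambda> t * \<theta> t"
    using curvature[of t] amplitude_pos[of t] by (intro mult_right_mono) auto
  also have "\<dots> \<le> L * (1 / 2)"
    using curvature_amplitude[of t] by simp
  finally show ?thesis
    using L_pos by (simp only: mult_le_cancel_left_pos)
qed

lemma horizon_pos: "0 < H i"
  using horizon[of i] by linarith

lemma stepsize_pos: "0 < stepsize i t"
  using L_pos amplitude_pos horizon_pos by (simp add: stepsize_def)

lemma stepsize_horizon: "stepsize i t * real (H i) = \<theta> t / L"
  using horizon_pos by (simp add: stepsize_def)

lemma obj_smooth: "L_smooth L obj" and obj_convex: "convex_on UNIV obj"
proof -
  have ne: "{1..m i} \<noteq> {}" for i
    using components[of i] by auto
  have node: "node_obj m \<phi> i = (\<lambda>x. 1 / real (card {1..m i}) * (\<Sum>j\<in>{1..m i}. \<phi> i j x))" for i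
    by (rule ext) (simp add: node_obj_def)
  have obj: "obj = (\<lambda>x. 1 / real (card (UNIV :: 'n set)) * (\<Sum>i\<in>UNIV. node_obj m \<phi> i x))"
    by (rule ext) (simp add: global_obj_def)
  have "L_smooth L (node_obj m \<phi> i)" for i
    unfolding node by (rule L_smooth_mean[OF finite_atLeastAtMost ne smooth])
  then show "L_smooth L obj"
    unfolding obj by (rule L_smooth_mean[OF finite UNIV_not_empty])
  have "convex_on UNIV (node_obj m \<phi> i)" for i
    unfolding node by (rule convex_on_mean[OF finite_atLeastAtMost ne convex])
  then show "convex_on UNIV obj"
    unfolding obj by (rule convex_on_mean[OF finite UNIV_not_empty])
qed

lemma obj_min: "obj xstar \<le> obj z"
  using minimizer by (simp add: is_arg_min_linorder)

lemma obj_measurable [measurable]: "obj \<in> borel_measurable borel"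
  using L_smooth_continuous[OF obj_smooth] by (rule borel_measurable_continuous_onI)

lemma gradient_obj_measurable [measurable]: "gradient obj \<in> borel_measurable borel"
  using L_smooth_continuous_gradient[OF obj_smooth] by (rule borel_measurable_continuous_onI)

lemma norm_gradient_obj_le:
  assumes "z \<in> cball xstar R"
  shows "norm (gradient obj z) \<le> L * R"
proof -
  have "gradient obj xstar = 0"
    using norm_gradient_le_gap[OF obj_smooth L_pos obj_min, of xstar] by simp
  then have "norm (gradient obj z) \<le> L * norm (z - xstar)"
    using L_smooth_gradient_diff[OF obj_smooth, of z xstar] by simp
  also have "\<dots> \<le> L * R"
    using assms L_pos by (intro mult_left_mono) (auto simp: dist_norm norm_minus_commute)
  finally show ?thesis .
qed

subsection \<open>The sigma-algebras\<close>

text \<open>The sigma-algebras are generated by preimages of arbitrary sets of multisets, but a minibatch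
  always lies in its finite sample space.\<close>

lemma batch_event:
  assumes "l < H i"
  shows "B i t l -` A \<inter> space M = B i t l -` (A \<inter> space (minibatch_space i)) \<inter> space M"
proof -
  have "B i t l \<omega> \<in> space (minibatch_space i)" if "\<omega> \<in> space M" for \<omega>
    using batch_meas[OF assms] that by (rule measurable_space)
  then show ?thesis
    by auto
qed

lemma batch_event_sets:
  assumes "l < H i"
  shows "B i t l -` A \<inter> space M \<in> sets M"
proof -
  have "A \<inter> space (minibatch_space i) \<in> sets (minibatch_space i)"
    by (simp add: minibatch_space_def)
  then show ?thesis
    by (subst batch_event[OF assms]) (rule measurable_sets[OF batch_meas[OF assms]])
qed

lemma round_events_sets: "round_events t \<subseteq> sets M"
proof
  fix a
  assume "a \<in> round_events t"
  then consider A where "a = x 0 -` A \<inter> space M" "A \<in> sets borel"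
    | i s l A where "a = B i s l -` A \<inter> space M" "l < H i"
    unfolding round_events_def by blast
  then show "a \<in> sets M"
  proof cases
    case 1
    then show ?thesis
      using measurable_sets[OF init_meas] by simp
  next
    case 2
    then show ?thesis
      using batch_event_sets by simp
  qed
qed

lemma round_events_mono:
  assumes "s \<le> t"
  shows "round_events s \<subseteq> round_events t"
  unfolding round_events_def
proof (intro Un_mono order_refl subsetI, elim CollectE exE conjE)
  fix a i r l A
  assume "a = B i r l -` A \<inter> space M" "r < s" "l < H i"
  moreover from this assms have "r < t"
    by simp
  ultimately show "a \<in> {B i r l -` A \<inter> space M | i r l A. r < t \<and> l < H i}"
    by blast
qed

text \<open>The generating events of the sigma-algebra of node \<open>i\<close> before local step \<open>l\<close>.\<close>

definition local_events :: "'n \<Rightarrow> nat \<Rightarrow> nat \<Rightarrow> 'w set set" where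
  "local_events i t l = round_events t \<union> {B i t k -` A \<inter> space M | k A. k < l}"

lemma local_events_mono:
  assumes "k \<le> l"
  shows "local_events i t k \<subseteq> local_events i t l"
  unfolding local_events_def
proof (intro Un_mono order_refl subsetI, elim CollectE exE conjE)
  fix a r A
  assume "a = B i t r -` A \<inter> space M" "r < k"
  moreover from this assms have "r < l"
    by simp
  ultimately show "a \<in> {B i t k -` A \<inter> space M | k A. k < l}"
    by blast
qed

lemma local_alg_eq: "local_alg i t l = sigma (space M) (local_events i t l)"
  by (simp add: local_alg_def local_events_def)

lemma local_events_subset_round_events:
  assumes "l \<le> H i"
  shows "local_events i t l \<subseteq> round_events (Suc t)"
proof -
  have "{B i t k -` A \<inter> space M | k A. k < l} \<subseteq> round_events (Suc t)"
  proof (intro subsetI, elim CollectE exE conjE)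
    fix a k A
    assume "a = B i t k -` A \<inter> space M" "k < l"
    moreover from this assms have "k < H i"
      by simp
    ultimately show "a \<in> round_events (Suc t)"
      unfolding round_events_def by blast
  qed
  then show ?thesis
    using round_events_mono[of t "Suc t"] by (simp add: local_events_def)
qed

lemma local_events_sets: "l \<le> H i \<Longrightarrow> local_events i t l \<subseteq> sets M"
  using local_events_subset_round_events round_events_sets by (rule subset_trans)

lemma subalgebra_sigma:
  assumes "E \<subseteq> sets M"
  shows "subalgebra M (sigma (space M) E)"
  using sets.sigma_sets_subset[OF assms] subset_trans[OF assms sets.space_closed]
  by (simp add: subalgebra_def space_measure_of_conv)

lemma subalgebra_sigma_mono:
  assumes "E \<subseteq> E'" "E' \<subseteq> sets M"
  shows "subalgebra (sigma (space M) E') (sigma (space M) E)"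
  using sigma_sets_mono'[OF assms(1), of "space M"] subset_trans[OF assms(2) sets.space_closed] assms(1)
  by (simp add: subalgebra_def space_measure_of_conv subset_trans[OF assms(1)])

lemma round_alg_sub: "subalgebra M (round_alg t)"
  unfolding round_alg_def by (rule subalgebra_sigma[OF round_events_sets])

lemma local_alg_sub: "l \<le> H i \<Longrightarrow> subalgebra M (local_alg i t l)"
  unfolding local_alg_eq by (rule subalgebra_sigma[OF local_events_sets])

lemma local_alg_mono: "k \<le> l \<Longrightarrow> l \<le> H i \<Longrightarrow> subalgebra (local_alg i t l) (local_alg i t k)"
  unfolding local_alg_eq by (intro subalgebra_sigma_mono local_events_mono local_events_sets)

lemma round_alg_sub_local_alg: "l \<le> H i \<Longrightarrow> subalgebra (local_alg i t l) (round_alg t)"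
  unfolding local_alg_eq round_alg_def
  by (rule subalgebra_sigma_mono[OF _ local_events_sets]) (simp_all add: local_events_def)

lemma local_alg_sub_round_alg: "l \<le> H i \<Longrightarrow> subalgebra (round_alg (Suc t)) (local_alg i t l)"
  unfolding local_alg_eq round_alg_def
  by (intro subalgebra_sigma_mono local_events_subset_round_events round_events_sets)

lemma round_alg_mono: "subalgebra (round_alg (Suc t)) (round_alg t)"
  unfolding round_alg_def
  by (intro subalgebra_sigma_mono round_events_sets round_events_mono) auto

lemma space_algs [simp]: "space (round_alg t) = space M" "space (local_alg i t l) = space M"
  by (simp_all add: round_alg_def local_alg_def space_measure_of_conv)

lemma round_events_sets_round_alg: "round_events t \<subseteq> sets (round_alg t)"
  unfolding round_alg_def using subset_trans[OF round_events_sets sets.space_closed] by auto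

lemma local_alg_0: "local_alg i t 0 = round_alg t"
  by (simp add: local_alg_def round_alg_def)

lemma y_meas_local_if_x_meas:
  assumes x: "x t \<in> borel_measurable (round_alg t)"
  shows "l \<le> H i \<Longrightarrow> y i t l \<in> borel_measurable (local_alg i t l)"
proof (induction l)
  case 0
  have "y i t 0 \<in> borel_measurable (local_alg i t 0) \<longleftrightarrow> x t \<in> borel_measurable (local_alg i t 0)"
    by (rule measurable_cong) (simp add: local_init)
  then show ?case
    using x by (simp add: local_alg_0)
next
  case (Suc l)
  have "y i t l \<in> borel_measurable (local_alg i t (Suc l))"
    by (rule measurable_from_subalg[OF local_alg_mono]) (use Suc in auto)
  moreover have "g i t l \<in> borel_measurable (local_alg i t (Suc l))"
    using grad_meas Suc by simp
  ultimately have "(\<lambda>\<omega>. y i t l \<omega> - stepsize i t *\<^sub>R g i t l \<omega>) \<in> borel_measurable (local_alg i t (Suc l))"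
    by simp
  moreover have "y i t (Suc l) \<in> borel_measurable (local_alg i t (Suc l)) \<longleftrightarrow>
      (\<lambda>\<omega>. y i t l \<omega> - stepsize i t *\<^sub>R g i t l \<omega>) \<in> borel_measurable (local_alg i t (Suc l))"
    using Suc by (intro measurable_cong) (simp add: local_step)
  ultimately show ?case
    by simp
qed

text \<open>A whole round is finished before the next one starts: the weights and the final local iterates
  of round \<open>t\<close> belong to the history of round \<open>t + 1\<close>.\<close>

lemma x_meas_round: "x t \<in> borel_measurable (round_alg t)"
proof (induction t)
  case 0
  show ?case
  proof (rule measurableI)
    fix A :: "'a set"
    assume "A \<in> sets borel"
    then have "x 0 -` A \<inter> space M \<in> round_events 0"
      by (auto simp: round_events_def)
    then show "x 0 -` A \<inter> space (round_alg 0) \<in> sets (round_alg 0)"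
      using round_events_sets_round_alg by auto
  qed simp
next
  case (Suc t)
  have [measurable]: "x t \<in> borel_measurable (round_alg (Suc t))"
    by (rule measurable_from_subalg[OF round_alg_mono Suc])
  have [measurable]: "y i t (H i) \<in> borel_measurable (round_alg (Suc t))" for i
    by (rule measurable_from_subalg[OF local_alg_sub_round_alg y_meas_local_if_x_meas[OF Suc]]) simp_all
  have [measurable]: "(\<lambda>\<omega>. w t \<omega> $ i) \<in> borel_measurable (round_alg (Suc t))" for i
    by (rule measurable_compose[OF weight_meas borel_measurable_continuous_onI]) (intro continuous_intros)
  have "(\<lambda>\<omega>. x t \<omega> + (\<Sum>i\<in>UNIV. (w t \<omega> $ i) *\<^sub>R (y i t (H i) \<omega> - x t \<omega>))) \<in> borel_measurable (round_alg (Suc t))"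
    by measurable
  moreover have "x (Suc t) \<in> borel_measurable (round_alg (Suc t)) \<longleftrightarrow>
      (\<lambda>\<omega>. x t \<omega> + (\<Sum>i\<in>UNIV. (w t \<omega> $ i) *\<^sub>R (y i t (H i) \<omega> - x t \<omega>))) \<in> borel_measurable (round_alg (Suc t))"
    by (rule measurable_cong) (simp add: server_step step_def displacement_def)
  ultimately show ?case
    by simp
qed

lemmas y_meas_local = y_meas_local_if_x_meas[OF x_meas_round]

lemma x_meas [measurable]: "x t \<in> borel_measurable M"
  by (rule measurable_from_subalg[OF round_alg_sub x_meas_round])

lemma noise_meas_local: "l < H i \<Longrightarrow> noise i t l \<in> borel_measurable (local_alg i t (Suc l))"
proof -
  assume l: "l < H i"
  then have [measurable]: "y i t l \<in> borel_measurable (local_alg i t (Suc l))"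
    by (intro measurable_from_subalg[OF local_alg_mono y_meas_local]) auto
  have [measurable]: "g i t l \<in> borel_measurable (local_alg i t (Suc l))"
    by (rule grad_meas[OF l])
  show ?thesis
    unfolding noise_def[abs_def] by measurable
qed

lemma noise_meas: "l < H i \<Longrightarrow> noise i t l \<in> borel_measurable M"
  by (rule measurable_from_subalg[OF local_alg_sub noise_meas_local]) auto

subsection \<open>Moments of the noise\<close>

lemma x_in_ball: "AE \<omega> in M. x t \<omega> \<in> cball xstar R"
  using iterates_in_ball by auto

lemma y_in_ball: "l \<le> H i \<Longrightarrow> AE \<omega> in M. y i t l \<omega> \<in> cball xstar R"
  using iterates_in_ball by auto

text \<open>Two consecutive local iterates in a ball bound the step between them.\<close>

lemma gradient_bounded:
  assumes "l < H i"
  shows "AE \<omega> in M. norm (g i t l \<omega>) \<le> 2 * R / stepsize i t"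
proof -
  have "AE \<omega> in M. y i t l \<omega> \<in> cball xstar R" "AE \<omega> in M. y i t (Suc l) \<omega> \<in> cball xstar R"
    using assms by (intro y_in_ball; simp)+
  then show ?thesis
    using AE_space
  proof eventually_elim
    case (elim \<omega>)
    have "norm (y i t l \<omega> - y i t (Suc l) \<omega>) \<le> norm (y i t l \<omega> - xstar) + norm (y i t (Suc l) \<omega> - xstar)"
      using norm_triangle_ineq4[of "y i t l \<omega> - xstar" "y i t (Suc l) \<omega> - xstar"] by simp
    then have "norm (y i t l \<omega> - y i t (Suc l) \<omega>) \<le> 2 * R"
      using elim by (simp add: dist_norm norm_minus_commute)
    moreover have "y i t l \<omega> - y i t (Suc l) \<omega> = stepsize i t *\<^sub>R g i t l \<omega>"
      using local_step[OF assms elim(3)] by simp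
    ultimately show ?case
      using stepsize_pos[of i t] by (simp add: pos_le_divide_eq mult.commute)
  qed
qed

lemma noise_bounded:
  assumes "l < H i"
  shows "AE \<omega> in M. norm (noise i t l \<omega>) \<le> 2 * R / stepsize i t + L * R"
  using gradient_bounded[OF assms, of t] y_in_ball[OF less_imp_le[OF assms], of t]
proof eventually_elim
  case (elim \<omega>)
  then show ?case
    using norm_triangle_ineq4[of "g i t l \<omega>" "gradient obj (y i t l \<omega>)"] norm_gradient_obj_le[of "y i t l \<omega>"]
    unfolding noise_def by linarith
qed

lemma integrable_gradient_coordinate:
  assumes "l < H i" "e \<in> Basis"
  shows "integrable M (\<lambda>\<omega>. g i t l \<omega> \<bullet> e)"
proof (rule integrable_const_bound)
  have [measurable]: "g i t l \<in> borel_measurable M"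
    by (rule measurable_from_subalg[OF local_alg_sub grad_meas]) (use assms in auto)
  show "(\<lambda>\<omega>. g i t l \<omega> \<bullet> e) \<in> borel_measurable M"
    by measurable
  show "AE \<omega> in M. norm (g i t l \<omega> \<bullet> e) \<le> 2 * R / stepsize i t"
    using gradient_bounded[OF assms(1), of t]
    by eventually_elim (simp add: order_trans[OF Basis_le_norm[OF assms(2)]])
qed

lemma noise_coordinate_bounded:
  assumes "l < H i" "e \<in> Basis"
  shows "AE \<omega> in M. \<bar>noise i t l \<omega> \<bullet> e\<bar> \<le> 2 * R / stepsize i t + L * R"
  using noise_bounded[OF assms(1), of t]
  by eventually_elim (rule order_trans[OF Basis_le_norm[OF assms(2)]])

lemma integrable_noise_coordinate:
  assumes "l < H i" "e \<in> Basis"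
  shows "integrable M (\<lambda>\<omega>. noise i t l \<omega> \<bullet> e)"
  using noise_coordinate_bounded[OF assms, of t] noise_meas[OF assms(1), of t]
  by (intro integrable_const_bound) auto

lemma integrable_noise_coordinate_product:
  assumes "l < H i" "k < H j" "e \<in> Basis"
  shows "integrable M (\<lambda>\<omega>. (noise j t k \<omega> \<bullet> e) * (noise i t l \<omega> \<bullet> e))"
proof (rule integrable_const_bound)
  have [measurable]: "noise i t l \<in> borel_measurable M" "noise j t k \<in> borel_measurable M"
    using assms noise_meas by auto
  show "(\<lambda>\<omega>. (noise j t k \<omega> \<bullet> e) * (noise i t l \<omega> \<bullet> e)) \<in> borel_measurable M"
    by measurable
  show "AE \<omega> in M. norm ((noise j t k \<omega> \<bullet> e) * (noise i t l \<omega> \<bullet> e))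
      \<le> (2 * R / stepsize j t + L * R) * (2 * R / stepsize i t + L * R)"
    using noise_coordinate_bounded[OF assms(1,3), of t] noise_coordinate_bounded[OF assms(2,3), of t]
    by eventually_elim (auto simp: abs_mult intro!: mult_mono)
qed

lemma noise_inner:
  "noise j t k \<omega> \<bullet> noise i t l \<omega> = (\<Sum>e\<in>Basis. (noise j t k \<omega> \<bullet> e) * (noise i t l \<omega> \<bullet> e))"
  by (rule euclidean_inner)

lemma integrable_noise_inner:
  assumes "l < H i" "k < H j"
  shows "integrable M (\<lambda>\<omega>. noise j t k \<omega> \<bullet> noise i t l \<omega>)"
  unfolding noise_inner using assms by (intro Bochner_Integration.integrable_sum integrable_noise_coordinate_product)

lemma noise_cond_mean:
  assumes l: "l < H i" and e: "e \<in> Basis"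
  shows "AE \<omega> in M. real_cond_exp M (local_alg i t l) (\<lambda>\<omega>. noise i t l \<omega> \<bullet> e) \<omega> = 0"
proof -
  interpret G: sigma_finite_subalgebra M "local_alg i t l"
    using l by (intro subalgebra_sigma_finite local_alg_sub) simp
  have y [measurable]: "y i t l \<in> borel_measurable (local_alg i t l)"
    using l by (intro y_meas_local) simp
  have D: "integrable M (\<lambda>\<omega>. gradient obj (y i t l \<omega>) \<bullet> e)"
  proof -
    have "(\<lambda>\<omega>. gradient obj (y i t l \<omega>) \<bullet> e) = (\<lambda>\<omega>. g i t l \<omega> \<bullet> e - noise i t l \<omega> \<bullet> e)"
      by (simp add: noise_def inner_diff_left)
    then show ?thesis
      using integrable_gradient_coordinate[OF l e] integrable_noise_coordinate[OF l e] by simp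
  qed
  have eq: "(\<lambda>\<omega>. noise i t l \<omega> \<bullet> e) = (\<lambda>\<omega>. g i t l \<omega> \<bullet> e - gradient obj (y i t l \<omega>) \<bullet> e)"
    by (simp add: noise_def inner_diff_left)
  have "AE \<omega> in M. real_cond_exp M (local_alg i t l) (\<lambda>\<omega>. g i t l \<omega> \<bullet> e - gradient obj (y i t l \<omega>) \<bullet> e) \<omega>
      = real_cond_exp M (local_alg i t l) (\<lambda>\<omega>. g i t l \<omega> \<bullet> e) \<omega>
        - real_cond_exp M (local_alg i t l) (\<lambda>\<omega>. gradient obj (y i t l \<omega>) \<bullet> e) \<omega>"
    using integrable_gradient_coordinate[OF l e] D by (rule G.real_cond_exp_diff)
  moreover have "AE \<omega> in M. real_cond_exp M (local_alg i t l) (\<lambda>\<omega>. gradient obj (y i t l \<omega>) \<bullet> e) \<omega>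
      = gradient obj (y i t l \<omega>) \<bullet> e"
    using D by (rule G.real_cond_exp_F_meas) measurable
  moreover have "AE \<omega> in M. real_cond_exp M (local_alg i t l) (\<lambda>\<omega>. g i t l \<omega> \<bullet> e) \<omega> = gradient obj (y i t l \<omega>) \<bullet> e"
    using oracle_mean[OF l, of t]
  proof eventually_elim
    case (elim \<omega>)
    have "vec_cond_exp M (local_alg i t l) (g i t l) \<omega> \<bullet> e
        = (\<Sum>u\<in>Basis. real_cond_exp M (local_alg i t l) (\<lambda>\<omega>. g i t l \<omega> \<bullet> u) \<omega> * (u \<bullet> e))"
      by (simp add: vec_cond_exp_def inner_sum_left)
    also have "\<dots> = (\<Sum>u\<in>Basis. if u = e then real_cond_exp M (local_alg i t l) (\<lambda>\<omega>. g i t l \<omega> \<bullet> u) \<omega> else 0)"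
      using e by (intro sum.cong refl) (auto simp: inner_Basis)
    also have "\<dots> = real_cond_exp M (local_alg i t l) (\<lambda>\<omega>. g i t l \<omega> \<bullet> e) \<omega>"
      using e by simp
    finally show ?case
      using elim by simp
  qed
  ultimately show ?thesis
    unfolding eq by eventually_elim simp
qed

lemma noise_second_moment:
  assumes l: "l < H i"
  shows "(LINT \<omega>|M. (norm (noise i t l \<omega>))\<^sup>2) \<le> node_var m \<phi> xstar R i / real (b i)"
proof -
  interpret G: sigma_finite_subalgebra M "local_alg i t l"
    using l by (intro subalgebra_sigma_finite local_alg_sub) simp
  have int: "integrable M (\<lambda>\<omega>. (norm (noise i t l \<omega>))\<^sup>2)"
    using integrable_noise_inner[OF l l] by (simp add: power2_norm_eq_inner)
  have "(LINT \<omega>|M. (norm (noise i t l \<omega>))\<^sup>2)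
      = (LINT \<omega>|M. real_cond_exp M (local_alg i t l) (\<lambda>\<omega>. (norm (noise i t l \<omega>))\<^sup>2) \<omega>)"
    using G.real_cond_exp_int(2)[OF int] by simp
  also have "\<dots> \<le> (LINT \<omega>|M. node_var m \<phi> xstar R i / real (b i))"
    using oracle_var[OF l, of t] G.real_cond_exp_int(1)[OF int]
    by (intro integral_mono_AE) (auto simp: noise_def)
  finally show ?thesis
    by (simp add: prob_space)
qed

lemma noise_orthogonal_same_node:
  assumes "k < l" "l < H i"
  shows "(LINT \<omega>|M. noise i t k \<omega> \<bullet> noise i t l \<omega>) = 0"
proof -
  have [measurable]: "noise i t k \<in> borel_measurable (local_alg i t l)"
    by (rule measurable_from_subalg[OF local_alg_mono noise_meas_local]) (use assms in auto)
  have [measurable]: "noise i t l \<in> borel_measurable M"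
    using assms noise_meas by auto
  have "(LINT \<omega>|M. (noise i t k \<omega> \<bullet> e) * (noise i t l \<omega> \<bullet> e)) = 0" if "e \<in> Basis" for e
    using assms that
    by (intro integral_mult_cond_mean_zero[OF local_alg_sub[of l i t]] noise_cond_mean
        integrable_noise_coordinate_product) auto
  then show ?thesis
    unfolding noise_inner using assms by (simp add: Bochner_Integration.integral_sum integrable_noise_coordinate_product)
qed

text \<open>The product events about the minibatches that node \<open>i\<close> draws in round \<open>t\<close>.\<close>

definition node_events :: "'n \<Rightarrow> nat \<Rightarrow> 'w set set" where
  "node_events i t = {\<Inter>k\<in>{..<H i}. B i t k -` A k \<inter> space M | A. \<forall>k. A k \<in> sets (minibatch_space i)}"

lemma node_events_sets: "node_events i t \<subseteq> sets M"
proof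
  fix P
  assume "P \<in> node_events i t"
  then obtain A where A: "P = (\<Inter>k\<in>{..<H i}. B i t k -` A k \<inter> space M)"
    by (auto simp: node_events_def)
  show "P \<in> sets M"
    unfolding A using horizon_pos[of i] by (intro sets.finite_INT batch_event_sets) auto
qed

lemma node_events_Int_stable: "Int_stable (node_events i t)"
proof (rule Int_stableI)
  fix P Q
  assume "P \<in> node_events i t" "Q \<in> node_events i t"
  then obtain A A' where A: "P = (\<Inter>k\<in>{..<H i}. B i t k -` A k \<inter> space M)" "\<forall>k. A k \<in> sets (minibatch_space i)"
    and A': "Q = (\<Inter>k\<in>{..<H i}. B i t k -` A' k \<inter> space M)" "\<forall>k. A' k \<in> sets (minibatch_space i)"
    by (auto simp: node_events_def)
  have "P \<inter> Q = (\<Inter>k\<in>{..<H i}. B i t k -` (A k \<inter> A' k) \<inter> space M)"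
    unfolding A(1) A'(1) using horizon_pos[of i] by auto
  moreover have "\<forall>k. A k \<inter> A' k \<in> sets (minibatch_space i)"
    using A(2) A'(2) by auto
  ultimately show "P \<inter> Q \<in> node_events i t"
    unfolding node_events_def by (intro CollectI exI[of _ "\<lambda>k. A k \<inter> A' k"] conjI)
qed

lemma node_event_single:
  assumes "l < H i"
  shows "B i t l -` A \<inter> space M \<in> node_events i t"
proof -
  let ?S = "space (minibatch_space i)"
  \<comment> \<open>Only sets inside the sample space are admitted in the definition, hence the intersection.\<close>
  define A' where "A' k = (if k = l then A \<inter> ?S else ?S)" for k
  have "B i t l -` A \<inter> space M = (\<Inter>k\<in>{..<H i}. B i t k -` A' k \<inter> space M)"
    using assms measurable_space[OF batch_meas] by (auto simp: A'_def split: if_splits)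
  moreover have "\<forall>k. A' k \<in> sets (minibatch_space i)"
    by (auto simp: A'_def minibatch_space_def)
  ultimately show ?thesis
    unfolding node_events_def by blast
qed

lemma space_node_events: "space M \<in> node_events i t"
  using node_event_single[of 0 i t UNIV] horizon_pos[of i] by simp

lemma local_alg_sub_node:
  "subalgebra (sigma (space M) (sets (round_alg t) \<union> node_events i t)) (local_alg i t (H i))"
proof -
  have "local_events i t (H i) \<subseteq> sets (round_alg t) \<union> node_events i t"
    unfolding local_events_def using round_events_sets_round_alg
    by (intro Un_mono) (auto simp: node_event_single)
  moreover have "sets (round_alg t) \<union> node_events i t \<subseteq> sets M"
    using round_alg_sub node_events_sets by (auto simp: subalgebra_def)
  ultimately show ?thesis
    unfolding local_alg_eq by (rule subalgebra_sigma_mono)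
qed

text \<open>Before the first local step a node knows exactly the history of the previous rounds, so the
  independence of the minibatches is available conditionally on that history.\<close>

lemma node_events_cond_indep:
  assumes "i \<noteq> j" and P: "P \<in> node_events i t" and Q: "Q \<in> node_events j t"
  shows "AE \<omega> in M. real_cond_exp M (round_alg t) (indicator (P \<inter> Q)) \<omega>
    = real_cond_exp M (round_alg t) (indicator P) \<omega> * real_cond_exp M (round_alg t) (indicator Q) \<omega>"
proof -
  obtain A A' where A: "P = (\<Inter>k\<in>{..<H i}. B i t k -` A k \<inter> space M)" "\<forall>k. A k \<in> sets (minibatch_space i)"
    and A': "Q = (\<Inter>k\<in>{..<H j}. B j t k -` A' k \<inter> space M)" "\<forall>k. A' k \<in> sets (minibatch_space j)"
    using P Q by (auto simp: node_events_def)
  define D where "D = (\<lambda>(a, k). if a = i then A k else A' k)"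
  let ?X = "\<lambda>(j, k). B j t k" and ?I = "{i} \<times> {..<H i}" and ?J = "{j} \<times> {..<H j}"
  let ?c = "\<lambda>J \<omega>. real_cond_exp M (round_alg t) (indicator (\<Inter>p\<in>J. ?X p -` D p \<inter> space M)) \<omega>"
  let ?p = "\<lambda>J \<omega>. \<Prod>p\<in>J. real_cond_exp M (round_alg t) (indicator (?X p -` D p \<inter> space M)) \<omega>"
  have ne: "?I \<noteq> {}" "?J \<noteq> {}"
    using horizon_pos by auto
  have factor: "AE \<omega> in M. ?c K \<omega> = ?p K \<omega>" if "K \<subseteq> ?I \<union> ?J" "K \<noteq> {}" for K
  proof -
    have "cond_indep_vars M (round_alg t) (\<lambda>(j, k). minibatch_space j) ?X {(j, k). k < H j}"
      using batches_indep[of 0 i t] horizon_pos[of i] by (simp add: local_alg_0)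
    moreover have "K \<subseteq> {(j, k). k < H j}" "finite K"
      using that(1) by (auto intro: finite_subset)
    moreover have "D \<in> (\<Pi> p\<in>K. sets ((\<lambda>(j, k). minibatch_space j) p))"
      using that(1) A(2) A'(2) assms(1) by (auto simp: D_def)
    ultimately show ?thesis
      using that(2) unfolding cond_indep_vars_def by blast
  qed
  have events: "(\<Inter>p\<in>?I. ?X p -` D p \<inter> space M) = P" "(\<Inter>p\<in>?J. ?X p -` D p \<inter> space M) = Q"
    using assms(1) by (auto simp: D_def A(1) A'(1))
  then have "(\<Inter>p\<in>?I \<union> ?J. ?X p -` D p \<inter> space M) = P \<inter> Q"
    by (simp only: INT_Un)
  note events = events this
  have split: "?p (?I \<union> ?J) \<omega> = ?p ?I \<omega> * ?p ?J \<omega>" for \<omega>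
    using assms(1) by (intro prod.union_disjoint) auto
  have "AE \<omega> in M. ?c (?I \<union> ?J) \<omega> = ?p (?I \<union> ?J) \<omega>" "AE \<omega> in M. ?c ?I \<omega> = ?p ?I \<omega>"
    "AE \<omega> in M. ?c ?J \<omega> = ?p ?J \<omega>"
    using ne by (intro factor; blast)+
  then show ?thesis
    unfolding events split by eventually_elim simp
qed

lemma noise_round_mean:
  assumes l: "l < H i" and e: "e \<in> Basis"
  shows "AE \<omega> in M. real_cond_exp M (round_alg t) (\<lambda>\<omega>. noise i t l \<omega> \<bullet> e) \<omega> = 0"
proof -
  interpret F: sigma_finite_subalgebra M "round_alg t"
    by (rule subalgebra_sigma_finite[OF round_alg_sub])
  let ?c = "real_cond_exp M (local_alg i t l) (\<lambda>\<omega>. noise i t l \<omega> \<bullet> e)"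
  have "AE \<omega> in M. real_cond_exp M (round_alg t) ?c \<omega> = real_cond_exp M (round_alg t) (\<lambda>\<omega>. noise i t l \<omega> \<bullet> e) \<omega>"
    using l e by (intro F.real_cond_exp_nested_subalg local_alg_sub round_alg_sub_local_alg integrable_noise_coordinate) auto
  moreover have "AE \<omega> in M. real_cond_exp M (round_alg t) ?c \<omega> = real_cond_exp M (round_alg t) (\<lambda>_. 0) \<omega>"
    using noise_cond_mean[OF l e] by (intro F.real_cond_exp_cong) auto
  moreover have "AE \<omega> in M. real_cond_exp M (round_alg t) (\<lambda>_. 0) \<omega> = 0"
    by (rule F.real_cond_exp_F_meas) auto
  ultimately show ?thesis
    by eventually_elim simp
qed

text \<open>The noise of node \<open>i\<close> is computed from the history and the minibatches of node \<open>i\<close>, and it has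
  mean zero given the history; so it is uncorrelated with whatever node \<open>j\<close> computes.\<close>

lemma noise_orthogonal_other_node:
  assumes ij: "i \<noteq> j" and l: "l < H i" "k < H j"
  shows "(LINT \<omega>|M. noise j t k \<omega> \<bullet> noise i t l \<omega>) = 0"
proof -
  have sub: "Suc l \<le> H i" if "l < H i" for l i
    using that by simp
  have meas [measurable]: "noise i t l \<in> borel_measurable (sigma (space M) (sets (round_alg t) \<union> node_events i t))"
    if "l < H i" for i l
    using measurable_from_subalg[OF local_alg_sub_node
        measurable_from_subalg[OF local_alg_mono[OF sub[OF that] order_refl] noise_meas_local[OF that]]] .
  have "(LINT \<omega>|M. (noise j t k \<omega> \<bullet> e) * (noise i t l \<omega> \<bullet> e)) = 0" if e: "e \<in> Basis" for e
    using l e meas[OF l(1)] meas[OF l(2)]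
    by (intro cond_indep_integral_mult_zero[OF round_alg_sub[of t] node_events_sets[of i t] node_events_Int_stable
          space_node_events node_events_sets[of j t] node_events_Int_stable space_node_events]
        node_events_cond_indep[OF ij] integrable_noise_coordinate integrable_noise_coordinate_product noise_round_mean) auto
  then show ?thesis
    unfolding noise_inner using assms by (simp add: Bochner_Integration.integral_sum integrable_noise_coordinate_product)
qed

lemma noise_orthogonal:
  assumes "l < H i" "k < H j" "(j, k) \<noteq> (i, l)"
  shows "(LINT \<omega>|M. noise j t k \<omega> \<bullet> noise i t l \<omega>) = 0"
proof (cases "i = j")
  case True
  then show ?thesis
    using assms noise_orthogonal_same_node[of k l i t] noise_orthogonal_same_node[of l k i t]
    by (cases k l rule: linorder_cases) (auto simp: inner_commute)
next
  case False
  then show ?thesis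
    using assms by (intro noise_orthogonal_other_node)
qed

text \<open>The variance bound of node \<open>i\<close> for one minibatch gradient.\<close>

abbreviation var_ratio :: "'n \<Rightarrow> real" where
  "var_ratio i \<equiv> node_var m \<phi> xstar R i / real (b i)"

lemma var_ratio_nonneg: "0 \<le> var_ratio i"
proof -
  have "0 \<le> (LINT \<omega>|M. (norm (noise i 0 0 \<omega>))\<^sup>2)"
    by simp
  also have "\<dots> \<le> var_ratio i"
    by (rule noise_second_moment[OF horizon_pos])
  finally show ?thesis .
qed

lemma V1_bar_eq: "V1_bar (node_var m \<phi> xstar R) H b = 1 / real CARD('n) * (\<Sum>i\<in>UNIV. var_ratio i / real (H i))"
  by (simp add: V1_bar_def mult.commute)

lemma V_u_eq: "V_u (node_var m \<phi> xstar R) H b = 1 / (real CARD('n))\<^sup>2 * (\<Sum>i\<in>UNIV. var_ratio i / real (H i))"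
  by (simp add: V_u_def mult.commute)

lemma V_nonneg: "0 \<le> V1_bar (node_var m \<phi> xstar R) H b" "0 \<le> V_u (node_var m \<phi> xstar R) H b"
  unfolding V1_bar_eq V_u_eq
  by (intro mult_nonneg_nonneg sum_nonneg divide_nonneg_nonneg var_ratio_nonneg; simp)+

lemma local_noise_moment:
  assumes "l \<le> H i"
  shows "integrable M (\<lambda>\<omega>. (norm (\<Sum>k<l. noise i t k \<omega>))\<^sup>2)"
    and "(LINT \<omega>|M. (norm (\<Sum>k<l. noise i t k \<omega>))\<^sup>2) \<le> real l * var_ratio i"
proof -
  have int: "integrable M (\<lambda>\<omega>. noise i t j \<omega> \<bullet> noise i t k \<omega>)" if "j \<in> {..<l}" "k \<in> {..<l}" for j k
    using that assms by (intro integrable_noise_inner) auto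
  have orth: "(LINT \<omega>|M. noise i t j \<omega> \<bullet> noise i t k \<omega>) = 0" if "j \<in> {..<l}" "k \<in> {..<l}" "j \<noteq> k" for j k
    using that assms by (intro noise_orthogonal) auto
  note pyth = integral_norm_sum_squared[of "{..<l}" "noise i t" "\<lambda>_. 1", OF finite_lessThan int orth, simplified]
  show "integrable M (\<lambda>\<omega>. (norm (\<Sum>k<l. noise i t k \<omega>))\<^sup>2)"
    by (rule pyth(1))
  have "(\<Sum>k<l. LINT \<omega>|M. (norm (noise i t k \<omega>))\<^sup>2) \<le> (\<Sum>k<l. var_ratio i)"
    using assms by (intro sum_mono noise_second_moment) auto
  then show "(LINT \<omega>|M. (norm (\<Sum>k<l. noise i t k \<omega>))\<^sup>2) \<le> real l * var_ratio i"
    using pyth(2) by simp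
qed

text \<open>The noise in the average of the local gradients.\<close>

definition mean_noise :: "nat \<Rightarrow> 'w \<Rightarrow> 'a" where
  "mean_noise t \<omega> = (1 / real CARD('n)) *\<^sub>R (\<Sum>i\<in>UNIV. (1 / real (H i)) *\<^sub>R (\<Sum>l<H i. noise i t l \<omega>))"

lemma mean_noise_moment:
  shows "integrable M (\<lambda>\<omega>. (norm (mean_noise t \<omega>))\<^sup>2)"
    and "(LINT \<omega>|M. (norm (mean_noise t \<omega>))\<^sup>2) \<le> V_u (node_var m \<phi> xstar R) H b"
proof -
  let ?K = "SIGMA i:UNIV. {..<H i}"
  define c where "c p = 1 / real CARD('n) * (1 / real (H (fst p)))" for p :: "'n \<times> nat"
  define \<xi> where "\<xi> p = noise (fst p) t (snd p)" for p :: "'n \<times> nat"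
  have eq: "mean_noise t \<omega> = (\<Sum>p\<in>?K. c p *\<^sub>R \<xi> p \<omega>)" for \<omega>
  proof -
    have "mean_noise t \<omega> = (\<Sum>i\<in>UNIV. \<Sum>l<H i. (1 / real CARD('n) * (1 / real (H i))) *\<^sub>R noise i t l \<omega>)"
      unfolding mean_noise_def by (simp only: scaleR_sum_right scaleR_scaleR)
    also have "\<dots> = (\<Sum>p\<in>?K. c p *\<^sub>R \<xi> p \<omega>)"
      by (subst sum.Sigma) (auto simp: c_def \<xi>_def intro!: sum.cong)
    finally show ?thesis .
  qed
  have fin: "finite ?K"
    by simp
  have int: "integrable M (\<lambda>\<omega>. \<xi> p \<omega> \<bullet> \<xi> q \<omega>)" if "p \<in> ?K" "q \<in> ?K" for p q
    unfolding \<xi>_def using that by (intro integrable_noise_inner) auto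
  have orth: "(LINT \<omega>|M. \<xi> p \<omega> \<bullet> \<xi> q \<omega>) = 0" if "p \<in> ?K" "q \<in> ?K" "p \<noteq> q" for p q
    unfolding \<xi>_def using that by (intro noise_orthogonal) (auto simp: prod_eq_iff)
  note pyth = integral_norm_sum_squared[of ?K \<xi> c, OF fin int orth]
  show "integrable M (\<lambda>\<omega>. (norm (mean_noise t \<omega>))\<^sup>2)"
    unfolding eq by (rule pyth(1))
  have "(LINT \<omega>|M. (norm (mean_noise t \<omega>))\<^sup>2) = (\<Sum>p\<in>?K. (c p)\<^sup>2 * (LINT \<omega>|M. (norm (\<xi> p \<omega>))\<^sup>2))"
    unfolding eq by (rule pyth(2))
  also have "\<dots> \<le> (\<Sum>p\<in>?K. (c p)\<^sup>2 * var_ratio (fst p))"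
    unfolding \<xi>_def by (intro sum_mono mult_left_mono noise_second_moment) auto
  also have "\<dots> = (\<Sum>i\<in>UNIV. \<Sum>l<H i. (c (i, l))\<^sup>2 * var_ratio i)"
    by (subst sum.Sigma) (auto intro!: sum.cong)
  also have "\<dots> = (\<Sum>i\<in>UNIV. 1 / (real CARD('n))\<^sup>2 * (var_ratio i / real (H i)))"
  proof (rule sum.cong[OF refl])
    fix i
    have "(\<Sum>l<H i. (c (i, l))\<^sup>2 * var_ratio i) = real (H i) * ((1 / real CARD('n) * (1 / real (H i)))\<^sup>2 * var_ratio i)"
      by (simp add: c_def)
    also have "\<dots> = 1 / (real CARD('n))\<^sup>2 * (var_ratio i / real (H i))"
      using horizon_pos[of i] by (simp add: power2_eq_square)
    finally show "(\<Sum>l<H i. (c (i, l))\<^sup>2 * var_ratio i) = 1 / (real CARD('n))\<^sup>2 * (var_ratio i / real (H i))" .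
  qed
  also have "\<dots> = V_u (node_var m \<phi> xstar R) H b"
    unfolding V_u_eq by (rule sum_distrib_left[symmetric])
  finally show "(LINT \<omega>|M. (norm (mean_noise t \<omega>))\<^sup>2) \<le> V_u (node_var m \<phi> xstar R) H b" .
qed

section \<open>The expected descent of one round\<close>

lemma local_step_noise:
  assumes "l < H i" "\<omega> \<in> space M"
  shows "y i t (Suc l) \<omega> = y i t l \<omega> - stepsize i t *\<^sub>R (gradient obj (y i t l \<omega>) + noise i t l \<omega>)"
  using local_step[OF assms] by (simp add: noise_def)

lemma local_grad_eq:
  assumes "\<omega> \<in> space M"
  shows "local_grad i t \<omega> = (1 / real (H i)) *\<^sub>R (\<Sum>l<H i. gradient obj (y i t l \<omega>) + noise i t l \<omega>)"
proof -
  have "y i t l \<omega> - x t \<omega> = - (stepsize i t *\<^sub>R (\<Sum>k<l. gradient obj (y i t k \<omega>) + noise i t k \<omega>))"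
    if "l \<le> H i" for l
    using that
  proof (induction l)
    case 0
    then show ?case
      using assms by (simp add: local_init)
  next
    case (Suc l)
    then show ?case
      using assms by (simp add: local_step_noise algebra_simps)
  qed
  then show ?thesis
    using stepsize_pos[of i t] by (simp add: local_grad_def displacement_def inverse_eq_divide)
qed

text \<open>The averaged local gradient differs from the gradient at the server iterate by a bias, due to
  the drift of the local iterates, and by the averaged noise.\<close>

lemma mean_grad_error:
  assumes \<omega>: "\<omega> \<in> space M"
  shows "(norm (gradient obj (x t \<omega>) - mean_grad t \<omega>))\<^sup>2 \<le> 8 * (\<theta> t)\<^sup>2 * (norm (gradient obj (x t \<omega>)))\<^sup>2
    + 8 * (\<theta> t)\<^sup>2 * (1 / real CARD('n) * (\<Sum>i\<in>UNIV. 1 / real (H i) ^ 3 * (\<Sum>l<H i. (norm (\<Sum>k<l. noise i t k \<omega>))\<^sup>2)))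
    + 2 * (norm (mean_noise t \<omega>))\<^sup>2"
proof -
  let ?G = "gradient obj (x t \<omega>)"
  define N where "N i = (\<Sum>l<H i. (norm (\<Sum>k<l. noise i t k \<omega>))\<^sup>2)" for i
  define r where "r i = (1 / real (H i)) *\<^sub>R (\<Sum>l<H i. ?G - gradient obj (y i t l \<omega>))" for i
  define bias where "bias = (1 / real CARD('n)) *\<^sub>R (\<Sum>i\<in>UNIV. r i)"
  have r: "?G - local_grad i t \<omega> = r i - (1 / real (H i)) *\<^sub>R (\<Sum>l<H i. noise i t l \<omega>)" for i
  proof -
    have "(1 / real (H i)) *\<^sub>R (\<Sum>l<H i. ?G) = ?G"
      using horizon_pos[of i] by (simp add: sum_constant_scaleR)
    then show ?thesis
      unfolding r_def local_grad_eq[OF \<omega>] by (simp add: sum_subtractf sum.distrib scaleR_diff_right scaleR_add_right)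
  qed
  have "?G - mean_grad t \<omega> = (1 / real CARD('n)) *\<^sub>R (\<Sum>i\<in>UNIV. ?G - local_grad i t \<omega>)"
    by (simp add: mean_grad_def sum_subtractf scaleR_diff_right sum_constant_scaleR)
  also have "\<dots> = bias + - mean_noise t \<omega>"
    unfolding r bias_def mean_noise_def by (simp add: sum_subtractf scaleR_diff_right)
  finally have split: "(norm (?G - mean_grad t \<omega>))\<^sup>2 \<le> 2 * (norm bias)\<^sup>2 + 2 * (norm (mean_noise t \<omega>))\<^sup>2"
    using norm_add_squared_le[of bias "- mean_noise t \<omega>"] by simp
  have "(norm (r i))\<^sup>2 \<le> 4 * (\<theta> t)\<^sup>2 * (norm ?G)\<^sup>2 + 4 * (\<theta> t)\<^sup>2 * (1 / real (H i) ^ 3 * N i)" for i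
  proof -
    have h: "0 < real (H i)"
      using horizon_pos[of i] by simp
    define \<eta> where "\<eta> = stepsize i t"
    have \<eta>: "0 \<le> \<eta>" "\<eta> * L * real (H i) = \<theta> t"
      using stepsize_pos[of i t] stepsize_horizon[of i t] L_pos by (auto simp: \<eta>_def field_simps)
    have "(\<Sum>l<H i. (norm (y i t l \<omega> - x t \<omega>))\<^sup>2) \<le> 4 * \<eta>\<^sup>2 * real (H i) ^ 3 * (norm ?G)\<^sup>2 + 4 * \<eta>\<^sup>2 * N i"
      unfolding N_def \<eta>_def
      by (rule local_drift[OF obj_smooth L_pos])
        (use \<omega> local_init local_step_noise \<eta> amplitude_le_half[of t] in \<open>simp_all add: \<eta>_def\<close>)
    have "(norm (r i))\<^sup>2 \<le> 1 / real (H i) * (\<Sum>l<H i. (norm (?G - gradient obj (y i t l \<omega>)))\<^sup>2)"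
      unfolding r_def using norm_mean_squared_le[of "{..<H i}"] horizon_pos[of i] by (simp add: lessThan_empty_iff)
    also have "\<dots> \<le> 1 / real (H i) * (\<Sum>l<H i. L\<^sup>2 * (norm (y i t l \<omega> - x t \<omega>))\<^sup>2)"
    proof (intro mult_left_mono sum_mono)
      fix l
      have "norm (?G - gradient obj (y i t l \<omega>)) \<le> L * norm (y i t l \<omega> - x t \<omega>)"
        using L_smooth_gradient_diff[OF obj_smooth, of "x t \<omega>" "y i t l \<omega>"] by (simp add: norm_minus_commute)
      then show "(norm (?G - gradient obj (y i t l \<omega>)))\<^sup>2 \<le> L\<^sup>2 * (norm (y i t l \<omega> - x t \<omega>))\<^sup>2"
        by (metis norm_ge_zero power_mono power_mult_distrib)
    qed simp
    also have "\<dots> = L\<^sup>2 / real (H i) * (\<Sum>l<H i. (norm (y i t l \<omega> - x t \<omega>))\<^sup>2)"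
      by (simp add: sum_distrib_left)
    also have "\<dots> \<le> L\<^sup>2 / real (H i) * (4 * \<eta>\<^sup>2 * real (H i) ^ 3 * (norm ?G)\<^sup>2 + 4 * \<eta>\<^sup>2 * N i)"
      by (rule mult_left_mono) (fact, simp)
    also have "\<dots> = 4 * (\<eta> * L * real (H i))\<^sup>2 * (norm ?G)\<^sup>2 + 4 * (\<eta> * L * real (H i))\<^sup>2 * (1 / real (H i) ^ 3 * N i)"
      using h by (simp add: field_simps power2_eq_square power3_eq_cube)
    finally show ?thesis
      unfolding \<eta>(2) .
  qed
  then have "(norm bias)\<^sup>2 \<le> 1 / real CARD('n) * (\<Sum>i\<in>UNIV. 4 * (\<theta> t)\<^sup>2 * (norm ?G)\<^sup>2 + 4 * (\<theta> t)\<^sup>2 * (1 / real (H i) ^ 3 * N i))"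
    unfolding bias_def
    by (intro order_trans[OF norm_mean_squared_le[OF finite UNIV_not_empty]] mult_left_mono sum_mono) auto
  also have "\<dots> = 4 * (\<theta> t)\<^sup>2 * (norm ?G)\<^sup>2 + 4 * (\<theta> t)\<^sup>2 * (1 / real CARD('n) * (\<Sum>i\<in>UNIV. 1 / real (H i) ^ 3 * N i))"
    by (simp add: sum.distrib sum_distrib_left add_divide_distrib sum_divide_distrib mult_ac)
  finally show ?thesis
    using split unfolding N_def by linarith
qed

text \<open>The optimal weights are compared with uniform weights, for which the server step is a multiple
  of the averaged local gradient.\<close>

lemma round_descent:
  assumes \<omega>: "\<omega> \<in> space M"
  shows "obj (x (Suc t) \<omega>) \<le> obj (x t \<omega>) - \<theta> t / (4 * L) * (norm (gradient obj (x t \<omega>)))\<^sup>2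
    + (\<theta> t / (2 * L) + 1 / (2 * (\<Lambda> t - L))) * (norm (gradient obj (x t \<omega>) - mean_grad t \<omega>))\<^sup>2"
proof -
  define u :: "real ^ 'n" where "u = (\<chi> i. 1 / real CARD('n))"
  have "u \<in> weight_simplex"
    by (simp add: weight_simplex_def u_def)
  then have opt: "Psi_hom t \<omega> (w t \<omega>) \<le> Psi_hom t \<omega> u"
    using weight_opt[OF \<omega>, of t] by (simp add: is_arg_min_linorder)
  have "displacement i t \<omega> = - ((\<theta> t / L) *\<^sub>R local_grad i t \<omega>)" for i
    using L_pos amplitude_pos[of t] by (simp add: local_grad_def stepsize_horizon)
  then have "step t \<omega> u = - ((\<theta> t / L) *\<^sub>R mean_grad t \<omega>)"
    by (simp add: step_def u_def mean_grad_def sum_negf scaleR_sum_right mult.commute)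
  then have "obj (x t \<omega> + step t \<omega> (w t \<omega>)) \<le> obj (x t \<omega>) - \<theta> t / (4 * L) * (norm (gradient obj (x t \<omega>)))\<^sup>2
    + (\<theta> t / (2 * L) + 1 / (2 * (\<Lambda> t - L))) * (norm (gradient obj (x t \<omega>) - mean_grad t \<omega>))\<^sup>2"
    using opt unfolding Psi_hom_def
    by (intro model_step_descent[OF obj_smooth L_pos curvature amplitude_pos curvature_amplitude])
  then show ?thesis
    using server_step[OF \<omega>] by simp
qed

lemma gap_bounds:
  assumes "z \<in> cball xstar R"
  shows "0 \<le> obj z - obj xstar" "obj z - obj xstar \<le> R * norm (gradient obj z)"
proof -
  show "0 \<le> obj z - obj xstar"
    using obj_min by simp
  show "obj z - obj xstar \<le> R * norm (gradient obj z)"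
    using assms by (intro gap_le_norm_gradient[OF obj_smooth obj_convex]) (simp add: dist_norm norm_minus_commute)
qed

lemma gap_le:
  assumes "z \<in> cball xstar R"
  shows "\<bar>obj z - obj xstar\<bar> \<le> L * R\<^sup>2"
proof -
  have "obj z - obj xstar \<le> R * (L * R)"
    using gap_bounds(2)[OF assms] norm_gradient_obj_le[OF assms] radius
    by (meson mult_left_mono less_imp_le order_trans)
  then show ?thesis
    using gap_bounds(1)[OF assms] by (simp add: power2_eq_square mult_ac)
qed

lemma integrable_gap: "integrable M (\<lambda>\<omega>. obj (x t \<omega>) - obj xstar)"
proof (rule integrable_const_bound)
  show "AE \<omega> in M. norm (obj (x t \<omega>) - obj xstar) \<le> L * R\<^sup>2"
    using x_in_ball[of t] by eventually_elim (use gap_le in simp)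
qed measurable

lemma integrable_gap_squared: "integrable M (\<lambda>\<omega>. (obj (x t \<omega>) - obj xstar)\<^sup>2)"
proof (rule integrable_const_bound)
  show "AE \<omega> in M. norm ((obj (x t \<omega>) - obj xstar)\<^sup>2) \<le> (L * R\<^sup>2)\<^sup>2"
    using x_in_ball[of t]
  proof eventually_elim
    case (elim \<omega>)
    then show ?case
      using power_mono[OF gap_le[OF elim] abs_ge_zero, of 2] by simp
  qed
qed measurable

lemma integrable_gradient_squared: "integrable M (\<lambda>\<omega>. (norm (gradient obj (x t \<omega>)))\<^sup>2)"
proof (rule integrable_const_bound)
  show "AE \<omega> in M. norm ((norm (gradient obj (x t \<omega>)))\<^sup>2) \<le> (L * R)\<^sup>2"
    using x_in_ball[of t] by eventually_elim (use norm_gradient_obj_le in \<open>simp add: power_mono\<close>)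
qed measurable

abbreviation gap :: "nat \<Rightarrow> real" where
  "gap \<equiv> opt_gap M m \<phi> xstar x"

lemma gap_nonneg: "0 \<le> gap t"
  unfolding opt_gap_def using obj_min by (intro integral_nonneg_AE) auto

lemma gap_squared_le: "(gap t)\<^sup>2 \<le> (LINT \<omega>|M. (obj (x t \<omega>) - obj xstar)\<^sup>2)"
  unfolding opt_gap_def by (rule integral_squared_ge[OF integrable_gap integrable_gap_squared])

lemma expected_gradient_bounds:
  defines "G t \<equiv> LINT \<omega>|M. (norm (gradient obj (x t \<omega>)))\<^sup>2"
  shows "G t \<le> 2 * L * gap t" "(gap t)\<^sup>2 \<le> R\<^sup>2 * G t"
proof -
  have "G t \<le> (LINT \<omega>|M. 2 * L * (obj (x t \<omega>) - obj xstar))"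
    unfolding G_def
    by (intro integral_mono integrable_gradient_squared integrable_mult_right integrable_gap
        norm_gradient_le_gap[OF obj_smooth L_pos obj_min])
  then show "G t \<le> 2 * L * gap t"
    by (simp add: opt_gap_def)
  have "(LINT \<omega>|M. (obj (x t \<omega>) - obj xstar)\<^sup>2) \<le> (LINT \<omega>|M. R\<^sup>2 * (norm (gradient obj (x t \<omega>)))\<^sup>2)"
  proof (intro integral_mono_AE integrable_gap_squared integrable_mult_right integrable_gradient_squared)
    show "AE \<omega> in M. (obj (x t \<omega>) - obj xstar)\<^sup>2 \<le> R\<^sup>2 * (norm (gradient obj (x t \<omega>)))\<^sup>2"
      using x_in_ball[of t]
    proof eventually_elim
      case (elim \<omega>)
      then show ?case
        using power_mono[OF gap_bounds(2)[OF elim] gap_bounds(1)[OF elim], of 2] by (simp add: power_mult_distrib)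
    qed
  qed
  then show "(gap t)\<^sup>2 \<le> R\<^sup>2 * G t"
    using gap_squared_le[of t] by (simp add: G_def)
qed

text \<open>The accumulated noise after \<open>l\<close> local steps has second moment at most \<open>l\<close> times the one-step
  bound; summing over \<open>l\<close> gives the factor \<open>1 / 2\<close> in the bound for \<open>S\<close>.\<close>

lemma expected_descent:
  "gap (Suc t) \<le> gap t - A_hom L R (\<theta> t) * (gap t)\<^sup>2 + beta_hom L (\<theta> t) (\<Lambda> t) * gap t
    + delta_hom L (V1_bar (node_var m \<phi> xstar R) H b) (V_u (node_var m \<phi> xstar R) H b) (\<theta> t) (\<Lambda> t)"
proof -
  let ?V1 = "V1_bar (node_var m \<phi> xstar R) H b" and ?Vu = "V_u (node_var m \<phi> xstar R) H b"
  define G where "G = (LINT \<omega>|M. (norm (gradient obj (x t \<omega>)))\<^sup>2)"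
  define K where "K = \<theta> t / (2 * L) + 1 / (2 * (\<Lambda> t - L))"
  define S where "S \<omega> = 1 / real CARD('n) * (\<Sum>i\<in>UNIV. 1 / real (H i) ^ 3 * (\<Sum>l<H i. (norm (\<Sum>k<l. noise i t k \<omega>))\<^sup>2))" for \<omega>
  have K: "0 \<le> K"
    using L_pos amplitude_pos[of t] curvature[of t] by (auto simp: K_def)
  have int_N: "integrable M (\<lambda>\<omega>. (norm (\<Sum>k<l. noise i t k \<omega>))\<^sup>2)" if "l \<in> {..<H i}" for i l
    using that by (intro local_noise_moment) simp
  have int_S: "integrable M S"
    unfolding S_def
    by (intro integrable_mult_right Bochner_Integration.integrable_sum int_N)
  have S: "(LINT \<omega>|M. S \<omega>) \<le> ?V1 / 2"
  proof -
    have inner: "(LINT \<omega>|M. (\<Sum>l<H i. (norm (\<Sum>k<l. noise i t k \<omega>))\<^sup>2))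
        = (\<Sum>l<H i. LINT \<omega>|M. (norm (\<Sum>k<l. noise i t k \<omega>))\<^sup>2)" for i
      by (rule Bochner_Integration.integral_sum[OF int_N])
    have "(LINT \<omega>|M. S \<omega>) = 1 / real CARD('n) * (\<Sum>i\<in>UNIV. 1 / real (H i) ^ 3 * (\<Sum>l<H i. LINT \<omega>|M. (norm (\<Sum>k<l. noise i t k \<omega>))\<^sup>2))"
      unfolding S_def
      by (subst integral_mult_right_zero, subst Bochner_Integration.integral_sum)
        (auto intro!: integrable_mult_right Bochner_Integration.integrable_sum int_N simp: inner)
    also have "\<dots> \<le> 1 / real CARD('n) * (\<Sum>i\<in>UNIV. 1 / real (H i) ^ 3 * ((real (H i))\<^sup>2 / 2 * var_ratio i))"
    proof (intro mult_left_mono sum_mono)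
      fix i
      have "(\<Sum>l<H i. LINT \<omega>|M. (norm (\<Sum>k<l. noise i t k \<omega>))\<^sup>2) \<le> (\<Sum>l<H i. real l * var_ratio i)"
        by (intro sum_mono local_noise_moment) simp
      also have "\<dots> = (\<Sum>l<H i. real l) * var_ratio i"
        by (rule sum_distrib_right[symmetric])
      also have "\<dots> \<le> (real (H i))\<^sup>2 / 2 * var_ratio i"
        by (intro mult_right_mono sum_lessThan_le_half_square var_ratio_nonneg)
      finally show "(\<Sum>l<H i. LINT \<omega>|M. (norm (\<Sum>k<l. noise i t k \<omega>))\<^sup>2) \<le> (real (H i))\<^sup>2 / 2 * var_ratio i" .
    qed auto
    also have "\<dots> = 1 / real CARD('n) * (\<Sum>i\<in>UNIV. var_ratio i / real (H i) / 2)"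
      using horizon_pos by (intro arg_cong2[of _ _ _ _ "(*)"] sum.cong refl) (simp add: power2_eq_square power3_eq_cube)
    also have "\<dots> = ?V1 / 2"
      unfolding V1_bar_eq by (simp add: sum_divide_distrib mult_ac)
    finally show ?thesis .
  qed
  have "gap (Suc t) \<le> (LINT \<omega>|M. (obj (x t \<omega>) - obj xstar) - \<theta> t / (4 * L) * (norm (gradient obj (x t \<omega>)))\<^sup>2
      + K * (8 * (\<theta> t)\<^sup>2 * (norm (gradient obj (x t \<omega>)))\<^sup>2 + 8 * (\<theta> t)\<^sup>2 * S \<omega> + 2 * (norm (mean_noise t \<omega>))\<^sup>2))"
    unfolding opt_gap_def
  proof (rule integral_mono)
    show "integrable M (\<lambda>\<omega>. (obj (x t \<omega>) - obj xstar) - \<theta> t / (4 * L) * (norm (gradient obj (x t \<omega>)))\<^sup>2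
      + K * (8 * (\<theta> t)\<^sup>2 * (norm (gradient obj (x t \<omega>)))\<^sup>2 + 8 * (\<theta> t)\<^sup>2 * S \<omega> + 2 * (norm (mean_noise t \<omega>))\<^sup>2))"
      by (intro Bochner_Integration.integrable_add Bochner_Integration.integrable_diff[OF integrable_gap] integrable_mult_right
          integrable_gradient_squared int_S mean_noise_moment)
  next
    fix \<omega>
    assume \<omega>: "\<omega> \<in> space M"
    show "obj (x (Suc t) \<omega>) - obj xstar \<le> (obj (x t \<omega>) - obj xstar) - \<theta> t / (4 * L) * (norm (gradient obj (x t \<omega>)))\<^sup>2
      + K * (8 * (\<theta> t)\<^sup>2 * (norm (gradient obj (x t \<omega>)))\<^sup>2 + 8 * (\<theta> t)\<^sup>2 * S \<omega> + 2 * (norm (mean_noise t \<omega>))\<^sup>2)"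
      using round_descent[OF \<omega>, of t] mult_left_mono[OF mean_grad_error[OF \<omega>, of t] K]
      unfolding K_def[symmetric] S_def[symmetric] by linarith
  qed (rule integrable_gap)
  also have "\<dots> = gap t - \<theta> t / (4 * L) * G
      + K * (8 * (\<theta> t)\<^sup>2 * G + 8 * (\<theta> t)\<^sup>2 * (LINT \<omega>|M. S \<omega>) + 2 * (LINT \<omega>|M. (norm (mean_noise t \<omega>))\<^sup>2))"
    unfolding opt_gap_def G_def
    using integrable_gap[of t] integrable_gradient_squared[of t] int_S mean_noise_moment(1)[of t] by simp
  also have "\<dots> \<le> gap t - A_hom L R (\<theta> t) * (gap t)\<^sup>2
      + K * (8 * (\<theta> t)\<^sup>2 * (2 * L * gap t) + 8 * (\<theta> t)\<^sup>2 * (?V1 / 2) + 2 * ?Vu)"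
  proof (intro add_mono diff_mono order_refl mult_left_mono K S mean_noise_moment(2))
    have "A_hom L R (\<theta> t) * (gap t)\<^sup>2 \<le> \<theta> t / (4 * L * R\<^sup>2) * (R\<^sup>2 * G)"
      using A_hom_bounds[OF L_pos radius amplitude_pos, of t] expected_gradient_bounds(2)[of t] L_pos amplitude_pos[of t]
      unfolding G_def by (intro mult_mono) auto
    then show "A_hom L R (\<theta> t) * (gap t)\<^sup>2 \<le> \<theta> t / (4 * L) * G"
      using radius by simp
    show "G \<le> 2 * L * gap t"
      unfolding G_def by (rule expected_gradient_bounds)
  qed auto
  \<comment> \<open>Nonnegative terms are added to reach the stated constants.\<close>
  also have "\<dots> \<le> gap t - A_hom L R (\<theta> t) * (gap t)\<^sup>2
      + (K * (8 * (\<theta> t)\<^sup>2 * (2 * L * gap t) + 8 * (\<theta> t)\<^sup>2 * (?V1 / 2) + 2 * ?Vu)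
        + K * (16 * L * (\<theta> t)\<^sup>2 * gap t + 4 * (\<theta> t)\<^sup>2 * ?V1))"
    using K L_pos gap_nonneg[of t] V_nonneg by simp
  also have "\<dots> = gap t - A_hom L R (\<theta> t) * (gap t)\<^sup>2
      + 2 * K * (16 * L * (\<theta> t)\<^sup>2 * gap t + 4 * (\<theta> t)\<^sup>2 * ?V1 + ?Vu)"
    by (simp add: algebra_simps)
  also have "2 * K = \<theta> t / L + 1 / (\<Lambda> t - L)"
    using L_pos curvature[of t] by (simp add: K_def field_simps)
  also have "(\<theta> t / L + 1 / (\<Lambda> t - L)) * (16 * L * (\<theta> t)\<^sup>2 * gap t + 4 * (\<theta> t)\<^sup>2 * ?V1 + ?Vu)
      = beta_hom L (\<theta> t) (\<Lambda> t) * gap t + delta_hom L ?V1 ?Vu (\<theta> t) (\<Lambda> t)"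
    using L_pos unfolding beta_hom_def delta_hom_def
    by (simp add: algebra_simps power2_eq_square power3_eq_cube)
  finally show ?thesis
    by simp
qed

subsection \<open>The noiseless case\<close>

lemma noise_eq_0:
  assumes "var_ratio i \<le> 0" "l < H i"
  shows "AE \<omega> in M. noise i t l \<omega> = 0"
proof -
  have int: "integrable M (\<lambda>\<omega>. (norm (noise i t l \<omega>))\<^sup>2)"
    using integrable_noise_inner[OF assms(2,2)] by (simp add: power2_norm_eq_inner)
  have "(LINT \<omega>|M. (norm (noise i t l \<omega>))\<^sup>2) = 0"
    using noise_second_moment[OF assms(2), of t] assms(1)
    by (intro antisym[OF _ integral_nonneg_AE]) auto
  then show ?thesis
    using integral_nonneg_eq_0_iff_AE[OF int] by simp
qed

text \<open>Without noise every node runs gradient descent on the same objective, and the new server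
  iterate is a convex combination of the results.\<close>

lemma noiseless_descent:
  assumes "\<And>i. var_ratio i \<le> 0"
  shows "gap (Suc t) \<le> gap t - A_hom L R (\<theta> t) * (gap t)\<^sup>2"
proof -
  have "AE \<omega> in M. \<forall>i. \<forall>l\<in>{..<H i}. noise i t l \<omega> = 0"
    using noise_eq_0[OF assms] by (simp add: AE_all_countable AE_ball_countable)
  then have step: "AE \<omega> in M. obj (x (Suc t) \<omega>) - obj xstar
      \<le> (obj (x t \<omega>) - obj xstar) - A_hom L R (\<theta> t) * (obj (x t \<omega>) - obj xstar)\<^sup>2"
    using iterates_in_ball AE_space
  proof eventually_elim
    case (elim \<omega>)
    let ?s = "(obj (x t \<omega>) - obj xstar) - A_hom L R (\<theta> t) * (obj (x t \<omega>) - obj xstar)\<^sup>2"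
    have node: "obj (y i t (H i) \<omega>) \<le> ?s + obj xstar" for i
    proof -
      have "obj (y i t (H i) \<omega>) - obj xstar
          \<le> (obj (y i t 0 \<omega>) - obj xstar) - A_hom L R (\<theta> t) * (obj (y i t 0 \<omega>) - obj xstar)\<^sup>2"
      proof (rule exact_local_descent[OF obj_smooth obj_convex obj_min L_pos radius horizon_pos amplitude_pos amplitude_le_half])
        show "y i t (Suc l) \<omega> = y i t l \<omega> - (\<theta> t / (L * real (H i))) *\<^sub>R gradient obj (y i t l \<omega>)" if "l < H i" for l
          using local_step_noise[OF that elim(3), of t] elim(1) that by (simp add: stepsize_def)
        show "y i t l \<omega> \<in> cball xstar R" if "l \<le> H i" for l
          using elim(2) that by blast
      qed
      then show ?thesis
        using local_init[OF elim(3)] by simp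
    qed
    have weights: "w t \<omega> \<in> weight_simplex"
      using weight_opt[OF elim(3), of t] by (simp add: is_arg_min_def)
    then have "x (Suc t) \<omega> = (\<Sum>i\<in>UNIV. (w t \<omega> $ i) *\<^sub>R y i t (H i) \<omega>)"
      using server_step[OF elim(3), of t]
      by (simp add: step_def displacement_def weight_simplex_def scaleR_diff_right sum_subtractf flip: scaleR_sum_left)
    then have "obj (x (Suc t) \<omega>) \<le> (\<Sum>i\<in>UNIV. w t \<omega> $ i * obj (y i t (H i) \<omega>))"
      using weights convex_on_sum[OF finite UNIV_not_empty obj_convex, of "\<lambda>i. w t \<omega> $ i" "\<lambda>i. y i t (H i) \<omega>"]
      by (simp add: weight_simplex_def)
    also have "\<dots> \<le> (\<Sum>i\<in>UNIV. w t \<omega> $ i * (?s + obj xstar))"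
      using weights node by (intro sum_mono mult_left_mono) (auto simp: weight_simplex_def)
    also have "\<dots> = ?s + obj xstar"
      using weights by (simp add: weight_simplex_def flip: sum_distrib_right)
    finally show ?case
      by simp
  qed
  have "gap (Suc t) \<le> (LINT \<omega>|M. (obj (x t \<omega>) - obj xstar) - A_hom L R (\<theta> t) * (obj (x t \<omega>) - obj xstar)\<^sup>2)"
    unfolding opt_gap_def using step
    by (intro integral_mono_AE integrable_gap Bochner_Integration.integrable_diff integrable_mult_right integrable_gap_squared)
  also have "\<dots> = gap t - A_hom L R (\<theta> t) * (LINT \<omega>|M. (obj (x t \<omega>) - obj xstar)\<^sup>2)"
    unfolding opt_gap_def using integrable_gap[of t] integrable_gap_squared[of t] by simp
  also have "\<dots> \<le> gap t - A_hom L R (\<theta> t) * (gap t)\<^sup>2"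
    using A_hom_bounds(1)[OF L_pos radius amplitude_pos, of t] gap_squared_le[of t]
    by (intro diff_left_mono mult_left_mono) auto
  finally show ?thesis .
qed

section \<open>The rate for constant schedules\<close>

lemma beta_hom_nonneg: "0 \<le> beta_hom L (\<theta> t) (\<Lambda> t)"
  using L_pos amplitude_pos[of t] curvature[of t] unfolding beta_hom_def
  by (intro add_nonneg_nonneg mult_nonneg_nonneg divide_nonneg_nonneg) auto

lemma delta_hom_nonneg:
  "0 \<le> delta_hom L (V1_bar (node_var m \<phi> xstar R) H b) (V_u (node_var m \<phi> xstar R) H b) (\<theta> t) (\<Lambda> t)"
  using L_pos amplitude_pos[of t] curvature[of t] V_nonneg unfolding delta_hom_def
  by (intro add_nonneg_nonneg mult_nonneg_nonneg divide_nonneg_nonneg) auto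

lemma delta_hom_nonpos_imp_noiseless:
  assumes "delta_hom L (V1_bar (node_var m \<phi> xstar R) H b) (V_u (node_var m \<phi> xstar R) H b) (\<theta> t) (\<Lambda> t) \<le> 0"
  shows "var_ratio i \<le> 0"
proof -
  let ?V1 = "V1_bar (node_var m \<phi> xstar R) H b" and ?Vu = "V_u (node_var m \<phi> xstar R) H b"
  let ?a = "4 * (\<theta> t ^ 3 / L) + 4 * ((\<theta> t)\<^sup>2 / (\<Lambda> t - L))"
  have a: "0 < ?a"
    using L_pos amplitude_pos[of t] curvature[of t] by (intro add_pos_pos mult_pos_pos divide_pos_pos) auto
  have "0 \<le> (\<theta> t / L + 1 / (\<Lambda> t - L)) * ?Vu"
    using L_pos amplitude_pos[of t] curvature[of t] V_nonneg
    by (intro add_nonneg_nonneg mult_nonneg_nonneg divide_nonneg_nonneg) auto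
  then have "?a * ?V1 \<le> 0"
    using assms unfolding delta_hom_def by linarith
  then have "?V1 \<le> 0"
    using a by (simp add: mult_le_0_iff)
  then have "(\<Sum>i\<in>UNIV. var_ratio i / real (H i)) \<le> 0"
    unfolding V1_bar_eq by (simp add: divide_le_0_iff)
  then have "(\<Sum>i\<in>UNIV. var_ratio i / real (H i)) = 0"
    by (intro antisym sum_nonneg divide_nonneg_nonneg var_ratio_nonneg) auto
  moreover have "\<forall>i\<in>UNIV. 0 \<le> var_ratio i / real (H i)"
    by (intro ballI divide_nonneg_nonneg var_ratio_nonneg) auto
  ultimately have "var_ratio i / real (H i) = 0"
    by (simp add: sum_nonneg_eq_0_iff)
  then show ?thesis
    using horizon_pos[of i] by auto
qed

text \<open>A level \<open>\<mu> = 0\<close> is admissible only if \<open>\<delta> = 0\<close>.  The one-round recursion does not suffice then,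
  because its linear term \<open>\<beta>\<close> remains; but there is no noise, and the gap decreases without it.\<close>

lemma constant_schedule_rate:
  assumes \<theta>: "\<And>t. \<theta> t = \<theta>c" and \<Lambda>: "\<And>t. \<Lambda> t = \<Lambda>c" and \<mu>: "0 \<le> \<mu>"
    and level: "A_hom L R \<theta>c * \<mu>\<^sup>2 - beta_hom L \<theta>c \<Lambda>c * \<mu>
      - delta_hom L (V1_bar (node_var m \<phi> xstar R) H b) (V_u (node_var m \<phi> xstar R) H b) \<theta>c \<Lambda>c \<ge> 0"
      "2 * A_hom L R \<theta>c * \<mu> \<le> 1 + beta_hom L \<theta>c \<Lambda>c"
  shows "ereal (gap T) \<le> ereal \<mu> + 1 / (inverse (ereal (max (gap 0 - \<mu>) 0)) + ereal (A_hom L R \<theta>c * real T))"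
proof -
  have A: "0 < A_hom L R \<theta>c"
    using A_hom_bounds(1)[OF L_pos radius amplitude_pos[of 0]] by (simp add: \<theta>)
  have nonneg: "0 \<le> beta_hom L \<theta>c \<Lambda>c"
    "0 \<le> delta_hom L (V1_bar (node_var m \<phi> xstar R) H b) (V_u (node_var m \<phi> xstar R) H b) \<theta>c \<Lambda>c"
    using beta_hom_nonneg[of 0] delta_hom_nonneg[of 0] by (simp_all add: \<theta> \<Lambda>)
  have "ereal (gap T - \<mu>) \<le> 1 / (inverse (ereal (max (gap 0 - \<mu>) 0)) + ereal (A_hom L R \<theta>c * real T))"
  proof (cases "\<mu> = 0")
    case True
    then have "var_ratio i \<le> 0" for i
      using level(1) by (intro delta_hom_nonpos_imp_noiseless[of 0]) (simp add: \<theta> \<Lambda>)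
    from noiseless_descent[OF this] have step: "gap (Suc t) \<le> gap t - A_hom L R \<theta>c * (gap t)\<^sup>2" for t
      by (simp add: \<theta>)
    have "gap (Suc t) \<le> 0" if "gap t \<le> 0" for t
      using step[of t] that gap_nonneg[of t] by simp
    with True show ?thesis
      using step A by (intro quadratic_recursion_bound) auto
  next
    case False
    then have \<mu>_pos: "0 < \<mu>"
      using \<mu> by simp
    have rec: "gap (Suc t) \<le> gap t - A_hom L R \<theta>c * (gap t)\<^sup>2 + beta_hom L \<theta>c \<Lambda>c * gap t
        + delta_hom L (V1_bar (node_var m \<phi> xstar R) H b) (V_u (node_var m \<phi> xstar R) H b) \<theta>c \<Lambda>c" for t
      using expected_descent[of t] by (simp add: \<theta> \<Lambda>)
    note shifted = shifted_recursion[OF A nonneg \<mu>_pos level rec]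
    show ?thesis
      using A shifted by (intro quadratic_recursion_bound[of _ "\<lambda>t. gap t - \<mu>"]) auto
  qed
  then have "ereal \<mu> + ereal (gap T - \<mu>)
      \<le> ereal \<mu> + 1 / (inverse (ereal (max (gap 0 - \<mu>) 0)) + ereal (A_hom L R \<theta>c * real T))"
    by (rule add_left_mono)
  then show ?thesis
    by simp
qed

end

theorem corollary4p5:
  fixes M :: "'w measure"
    and m :: "'n::finite \<Rightarrow> nat"
    and \<phi> :: "'n \<Rightarrow> nat \<Rightarrow> 'a::euclidean_space \<Rightarrow> real"
    and L R \<theta>lo \<theta>hi :: real and xstar :: 'a
    and H b :: "'n \<Rightarrow> nat" and \<theta> \<Lambda> :: "nat \<Rightarrow> real"
    and B :: "'n \<Rightarrow> nat \<Rightarrow> nat \<Rightarrow> 'w \<Rightarrow> nat multiset"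
    and g y :: "'n \<Rightarrow> nat \<Rightarrow> nat \<Rightarrow> 'w \<Rightarrow> 'a"
    and x :: "nat \<Rightarrow> 'w \<Rightarrow> 'a" and w :: "nat \<Rightarrow> 'w \<Rightarrow> real ^ 'n"
  defines "gap \<equiv> opt_gap M m \<phi> xstar x"
    and "V1 \<equiv> V1_bar (node_var m \<phi> xstar R) H b"
    and "Vu \<equiv> V_u (node_var m \<phi> xstar R) H b"
  assumes alg: "hom_post_local M m \<phi> L xstar R H b \<theta>lo \<theta>hi \<theta> \<Lambda> B g y x w"
    and curv: "\<And>t. L < \<Lambda> t \<and> \<Lambda> t \<le> 2 * L"
    and prod: "\<And>t. \<Lambda> t * \<theta> t \<le> L / 2"
  shows "(\<forall>t. gap (Suc t) \<le> gap t - A_hom L R (\<theta> t) * (gap t)\<^sup>2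
             + beta_hom L (\<theta> t) (\<Lambda> t) * gap t + delta_hom L V1 Vu (\<theta> t) (\<Lambda> t)) \<and>
    (\<forall>\<theta>c \<Lambda>c mhom. (\<forall>t. \<theta> t = \<theta>c) \<longrightarrow> (\<forall>t. \<Lambda> t = \<Lambda>c) \<longrightarrow> 0 \<le> mhom \<longrightarrow>
       A_hom L R \<theta>c * mhom\<^sup>2 - beta_hom L \<theta>c \<Lambda>c * mhom - delta_hom L V1 Vu \<theta>c \<Lambda>c \<ge> 0 \<longrightarrow>
       2 * A_hom L R \<theta>c * mhom \<le> 1 + beta_hom L \<theta>c \<Lambda>c \<longrightarrow>
       (\<forall>T. ereal (gap T) \<le> ereal mhom +
              1 / (inverse (ereal (max (gap 0 - mhom) 0)) + ereal (A_hom L R \<theta>c * real T))))"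
proof -
  interpret R: curved_post_local M m \<phi> L xstar R H b \<theta>lo \<theta>hi \<theta> \<Lambda> B g y x w
    using alg curv prod by (simp add: curved_post_local_def curved_post_local_axioms_def)
  show ?thesis
    unfolding gap_def V1_def Vu_def
    using R.expected_descent R.constant_schedule_rate by blast
qed

end
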